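(* Let $T$ be an operator from a Banach lattice $E$ into a Banach space $X$. The following assertions are equivalent: (1) $T$ is $b$-weakly compact; (2) for every $b$-order bounded sequence $(x_n)\subset E^+$, $x_n\xrightarrow{uaw}0$ implies $q_T(x_n)\to0$; (3) for every $b$-order bounded sequence $(x_n)\subset E^+$, $x_n\xrightarrow{uaw}0$ implies $\|T(x_n)\|\to0$; (4) for every $b$-order bounded disjoint sequence $(x_n)\subset E^+$, $\|T(x_n)\|\to0$.
   Context: Operator means bounded linear operator. $E^+$ denotes the positive cone of $E$ and $E''$ its topological bidual, a Banach lattice containing $E$ canonically. A subset (or sequence) of $E$ is $b$-order bounded if it is order bounded when viewed in $E''$. An operator $T\colon E\to X$ is $b$-weakly compact if it maps every $b$-order bounded subset of $E$ to a relatively weakly compact subset of $X$. The lattice seminorm $q_T$ on $E$ is defined by $q_T(x)=\sup\{\|T(y)\|: y\in E,\ |y|\le|x|\}$ for $x\in E$. A sequence $(x_n)$ in $E$ satisfies $x_n\xrightarrow{uaw}0$ if $|x_n|\wedge u\to0$ weakly for every $u\in E^+$. A sequence $(x_n)$ is disjoint if $|x_n|\wedge|x_m|=0$ for $n\ne m$. *)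

theory Defs
  imports "HOL-Analysis.Analysis" "HOL-Library.Lattice_Algebras"
begin

class banach_lattice = banach + lattice_ab_group_add_abs + ordered_real_vector +
  assumes norm_lattice_mono: "\<bar>x\<bar> \<le> \<bar>y\<bar> \<Longrightarrow> norm x \<le> norm y"

instance real :: banach_lattice
  by standard simp

text \<open>
  Operators are ordered by their values on the positive cone. At type \<open>'a \<Rightarrow>\<^sub>L real\<close> this is the
  order of the dual of \<open>'a\<close>; using the instance twice, \<open>('a \<Rightarrow>\<^sub>L real) \<Rightarrow>\<^sub>L real\<close> carries the
  order of the bidual.
\<close>

instantiation blinfun :: ("{real_normed_vector, preorder}", "{real_normed_vector, preorder}") preorder
begin

definition less_eq_blinfun :: "'a \<Rightarrow>\<^sub>L 'b \<Rightarrow> 'a \<Rightarrow>\<^sub>L 'b \<Rightarrow> bool"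
  where "less_eq_blinfun f g \<longleftrightarrow> (\<forall>x\<ge>0. blinfun_apply f x \<le> blinfun_apply g x)"

definition less_blinfun :: "'a \<Rightarrow>\<^sub>L 'b \<Rightarrow> 'a \<Rightarrow>\<^sub>L 'b \<Rightarrow> bool"
  where "less_blinfun f g \<longleftrightarrow> f \<le> g \<and> \<not> g \<le> f"

instance
  by standard (auto simp: less_eq_blinfun_def less_blinfun_def intro: order_trans)

end

definition bidual_embedding :: "'a::real_normed_vector \<Rightarrow> ('a \<Rightarrow>\<^sub>L real) \<Rightarrow>\<^sub>L real"
  where "bidual_embedding x = Blinfun (\<lambda>f. blinfun_apply f x)"

lemma bidual_embedding_apply [simp]: "blinfun_apply (bidual_embedding x) f = blinfun_apply f x"
  unfolding bidual_embedding_def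
  by (simp add: bounded_linear_Blinfun_apply blinfun.bounded_linear_left)

definition b_order_bounded :: "'a::banach_lattice set \<Rightarrow> bool"
  where "b_order_bounded A \<longleftrightarrow>
    bdd_below (bidual_embedding ` A) \<and> bdd_above (bidual_embedding ` A)"

definition weak_topology :: "'a::real_normed_vector topology"
  where "weak_topology =
    topology_generated_by {blinfun_apply f -` U |(f :: 'a \<Rightarrow>\<^sub>L real) U. open U}"

definition relatively_weakly_compact :: "'a::real_normed_vector set \<Rightarrow> bool"
  where "relatively_weakly_compact A \<longleftrightarrow> compactin weak_topology (weak_topology closure_of A)"

definition b_weakly_compact :: "('a::banach_lattice \<Rightarrow>\<^sub>L 'b::banach) \<Rightarrow> bool"
  where "b_weakly_compact T \<longleftrightarrow>
    (\<forall>A. b_order_bounded A \<longrightarrow> relatively_weakly_compact (blinfun_apply T ` A))"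

definition q_seminorm :: "('a::banach_lattice \<Rightarrow>\<^sub>L 'b::banach) \<Rightarrow> 'a \<Rightarrow> real"
  where "q_seminorm T x = (SUP y\<in>{y. \<bar>y\<bar> \<le> \<bar>x\<bar>}. norm (blinfun_apply T y))"

text \<open>The set in the definition of \<open>q_seminorm\<close> is bounded, so the real supremum is the true one.\<close>

lemma bdd_above_q_seminorm: "bdd_above ((\<lambda>y. norm (blinfun_apply T y)) ` {y. \<bar>y\<bar> \<le> \<bar>x\<bar>})"
  for x :: "'a::banach_lattice"
proof (rule bdd_aboveI2)
  fix y assume "y \<in> {y. \<bar>y\<bar> \<le> \<bar>x\<bar>}"
  then have "norm T * norm y \<le> norm T * norm x"
    by (intro mult_left_mono norm_lattice_mono) auto
  with norm_blinfun[of T y] show "norm (blinfun_apply T y) \<le> norm T * norm x"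
    by linarith
qed

definition uaw_null :: "(nat \<Rightarrow> 'a::banach_lattice) \<Rightarrow> bool"
  where "uaw_null x \<longleftrightarrow>
    (\<forall>u\<ge>0. limitin weak_topology (\<lambda>n. inf \<bar>x n\<bar> u) 0 sequentially)"

definition disjoint_seq :: "(nat \<Rightarrow> 'a::banach_lattice) \<Rightarrow> bool"
  where "disjoint_seq x \<longleftrightarrow> (\<forall>n m. n \<noteq> m \<longrightarrow> inf \<bar>x n\<bar> \<bar>x m\<bar> = 0)"

end

theory Submission
  imports Defs
begin

text \<open>
  The cycle is (1) \<open>\<Rightarrow>\<close> (4) \<open>\<Rightarrow>\<close> (2) \<open>\<Rightarrow>\<close> (3) \<open>\<Rightarrow>\<close> (4) \<open>\<Rightarrow>\<close> (1). Disjoint sequences are uaw-null, which gives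
  (3) \<open>\<Rightarrow>\<close> (4), and (2) \<open>\<Rightarrow>\<close> (3) is clear.

  Everything that starts from (4) is expressed through the lattice seminorm \<open>q = q\<^sub>T\<close>. By (4),
  a \<open>b\<close>-order bounded set is, up to a \<open>q\<close>-small error, contained in an order interval \<open>{- u..u}\<close> of
  the lattice itself, and on order intervals increasing sequences are \<open>q\<close>-Cauchy. The latter makes
  \<open>q\<close> absolutely continuous with respect to a positive functional \<open>\<mu>\<close> on \<open>{0..u}\<close>, up to any given
  \<open>\<epsilon>\<close>. Since \<open>\<mu>\<close> is weakly continuous, (2) follows. For (1), a point in the weak* closure of \<open>T A\<close> in
  the bidual is approached along a directed family of convex sets, and near-minimizers of a
  convex functional built from \<open>\<mu>\<close> approach it even in norm, so it lies in the codomain of \<open>T\<close>.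

  For (1) \<open>\<Rightarrow>\<close> (4), the partial sums of a disjoint \<open>b\<close>-order bounded sequence are \<open>b\<close>-order bounded,
  and a gliding hump argument in the manner of Orlicz and Pettis applies to their images.
\<close>

section \<open>Vector lattices\<close>

text \<open>A Banach lattice need not be order complete and is not given as a space of functions, so
  suprema of infinite families and band projections are not at hand. Two substitutes shape the
  proof. The region where a level \<open>t u\<close> lies between \<open>x\<close> and
  \<open>y\<close> is represented by
  \<open>inf (pprt (y - t *\<^sub>R u)) (pprt (t *\<^sub>R u - x))\<close>, and finitely many levels
  recover the truncated difference of \<open>x\<close> and \<open>y\<close> up to the mesh. Infinite
  suprema are replaced by finite ones beyond which the further increase is small in
  \<open>q\<close>. Of the bidual only the order against positive functionals enters. The one
  lattice property needed there, that a common bound for \<open>x\<close> and \<open>y\<close>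
  bounds \<open>sup x y\<close>, is the Riesz-Kantorovich formula in disguise and comes from
  Hahn-Banach. It yields the bounds on partial sums of disjoint sequences and on the moduli of
  differences.\<close>

lemma inf_plus_pprt_diff: "inf x y + pprt (x - y) = x"
  for x y :: "'a::lattice_ab_group_add"
proof -
  have "pprt (x - y) + y = sup x y"
    by (simp add: pprt_def add_sup_distrib_right)
  with add_eq_inf_sup[of x y] have "(inf x y + pprt (x - y)) + y = x + y"
    by (simp add: ac_simps)
  then show ?thesis by simp
qed

lemma pprt_add_le: "pprt (x + y) \<le> pprt x + pprt y"
  for x y :: "'a::lattice_ab_group_add"
  unfolding pprt_def by (rule le_supI) (auto intro: add_mono add_nonneg_nonneg)

lemma le_pprt: "x \<le> pprt x"
  for x :: "'a::lattice_ab_group_add"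
  by (simp add: pprt_def)

lemma pprt_le_iff: "pprt x \<le> y \<longleftrightarrow> x \<le> y \<and> 0 \<le> y"
  for x y :: "'a::lattice_ab_group_add"
  by (simp add: pprt_def)

lemma pprt_sup_le: "pprt (sup x y) \<le> pprt x + pprt y"
  for x y :: "'a::lattice_ab_group_add"
proof -
  have "x \<le> pprt x + pprt y"
    using add_mono[OF le_pprt[of x] zero_le_pprt[of y]] by simp
  moreover have "y \<le> pprt x + pprt y"
    using add_mono[OF zero_le_pprt[of x] le_pprt[of y]] by simp
  ultimately show ?thesis
    by (simp add: pprt_le_iff)
qed

lemma pprt_diff_pprt_minus: "pprt x - pprt (- x) = x"
  for x :: "'a::lattice_ab_group_add"
  by (simp add: pprt_neg flip: prts)

lemma abs_eq_pprt_add: "\<bar>x\<bar> = pprt x + pprt (- x)"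
  for x :: "'a::lattice_ab_group_add_abs"
  by (simp add: abs_prts pprt_neg)

lemma abs_pprt_le: "\<bar>pprt x\<bar> \<le> \<bar>x\<bar>"
  for x :: "'a::lattice_ab_group_add_abs"
  by (simp add: abs_eq_pprt_add[of x])

text \<open>Adding \<open>x\<close> turns \<open>pprt (- x)\<close> into \<open>pprt x\<close>, so
  the infimum plus \<open>x\<close> becomes \<open>pprt x + inf x 0\<close>, which is
  \<open>x\<close> again.\<close>

lemma inf_pprt_pprt_minus: "inf (pprt x) (pprt (- x)) = 0"
  for x :: "'a::lattice_ab_group_add"
proof -
  have "inf (pprt x) (pprt (- x)) + x = inf (pprt x + x) (pprt x)"
    using pprt_diff_pprt_minus[of x]
    by (simp only: add_inf_distrib_right diff_eq_eq add.commute[of x])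
  moreover have "pprt x + x = sup (x + x) x"
    by (simp add: pprt_def add_sup_distrib_right)
  moreover have "inf (pprt x + x) (pprt x) = pprt x + inf x 0"
    by (simp add: add_inf_distrib_left)
  moreover have "pprt x + inf x 0 = x"
    using prts[of x] by (simp add: nprt_def)
  ultimately show ?thesis by simp
qed

lemma inf_add_le: "inf (x + y) z \<le> inf x z + inf y z"
  if "0 \<le> x" "0 \<le> y" "0 \<le> z" for x y z :: "'a::lattice_ab_group_add"
proof -
  have "inf x z + inf y z = inf (inf (x + y) (x + z)) (inf (z + y) (z + z))"
    by (simp add: add_inf_distrib_left add_inf_distrib_right inf_aci)
  moreover have "inf (x + y) z \<le> inf (inf (x + y) (x + z)) (inf (z + y) (z + z))"
    using that by (auto intro!: le_infI intro: le_infI2 simp: add_increasing add_increasing2)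
  ultimately show ?thesis by simp
qed

lemma disjoint_mono: "inf x y = 0"
  if "inf x' y' = 0" "0 \<le> x" "x \<le> x'" "0 \<le> y" "y \<le> y'"
  for x y :: "'a::lattice_ab_group_add"
proof (rule antisym)
  show "inf x y \<le> 0"
    using that(1) inf_mono[OF that(3,5)] by simp
qed (use that in simp)

text \<open>Adding the excess \<open>?r\<close> of \<open>sup x y\<close> over \<open>z\<close> to
  both sides reduces the claim to \<open>sup x y \<le> ?d + ?r\<close>, which can be checked for
  \<open>x\<close> and \<open>y\<close> separately.\<close>

lemma inf_sup_le_distrib: "inf (sup x y) z \<le> sup (inf x z) (inf y z)"
  for x y z :: "'a::lattice_ab_group_add"
proof -
  let ?d = "sup (inf x z) (inf y z)" and ?r = "pprt (sup x y - z)"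
  have "x \<le> ?d + ?r"
  proof -
    have "inf x z + pprt (x - z) \<le> ?d + ?r"
      by (intro add_mono pprt_mono diff_right_mono) auto
    then show ?thesis by (simp add: inf_plus_pprt_diff)
  qed
  moreover have "y \<le> ?d + ?r"
  proof -
    have "inf y z + pprt (y - z) \<le> ?d + ?r"
      by (intro add_mono pprt_mono diff_right_mono) auto
    then show ?thesis by (simp add: inf_plus_pprt_diff)
  qed
  ultimately have "sup x y \<le> ?d + ?r" by simp
  then have "inf (sup x y) z + ?r \<le> ?d + ?r"
    by (simp only: inf_plus_pprt_diff)
  then show ?thesis by simp
qed

lemma scaleR_inf: "c *\<^sub>R inf x y = inf (c *\<^sub>R x) (c *\<^sub>R y)" if "0 \<le> c"
  for x y :: "'a::{lattice_ab_group_add, ordered_real_vector}"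
proof (cases "c = 0")
  case False
  with that have c: "c > 0" by simp
  show ?thesis
  proof (rule antisym)
    show "c *\<^sub>R inf x y \<le> inf (c *\<^sub>R x) (c *\<^sub>R y)"
      using that by (auto intro: scaleR_left_mono)
    have "inverse c *\<^sub>R inf (c *\<^sub>R x) (c *\<^sub>R y) \<le> inverse c *\<^sub>R (c *\<^sub>R x)"
      "inverse c *\<^sub>R inf (c *\<^sub>R x) (c *\<^sub>R y) \<le> inverse c *\<^sub>R (c *\<^sub>R y)"
      using c by (intro scaleR_left_mono; simp)+
    then have "inverse c *\<^sub>R inf (c *\<^sub>R x) (c *\<^sub>R y) \<le> inf x y"
      using c by simp
    then have "c *\<^sub>R (inverse c *\<^sub>R inf (c *\<^sub>R x) (c *\<^sub>R y)) \<le> c *\<^sub>R inf x y"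
      using c by (intro scaleR_left_mono) auto
    then show "inf (c *\<^sub>R x) (c *\<^sub>R y) \<le> c *\<^sub>R inf x y"
      using c by simp
  qed
qed simp

lemma scaleR_sup: "c *\<^sub>R sup x y = sup (c *\<^sub>R x) (c *\<^sub>R y)" if "0 \<le> c"
  for x y :: "'a::{lattice_ab_group_add, ordered_real_vector}"
proof -
  have "c *\<^sub>R sup x y = - (c *\<^sub>R inf (- x) (- y))"
    by (simp flip: scaleR_minus_right)
  also have "\<dots> = sup (c *\<^sub>R x) (c *\<^sub>R y)"
    by (simp add: scaleR_inf[OF that])
  finally show ?thesis .
qed

lemma scaleR_pprt: "c *\<^sub>R pprt x = pprt (c *\<^sub>R x)" if "0 \<le> c"
  for x :: "'a::{lattice_ab_group_add, ordered_real_vector}"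
  using scaleR_sup[OF that, of x 0] by (simp add: pprt_def)

lemma abs_scaleR: "\<bar>c *\<^sub>R x\<bar> = \<bar>c\<bar> *\<^sub>R \<bar>x\<bar>"
  for x :: "'a::{lattice_ab_group_add_abs, ordered_real_vector}"
proof -
  have *: "\<bar>d *\<^sub>R x\<bar> = d *\<^sub>R \<bar>x\<bar>" if "0 \<le> d" for d
    by (simp add: abs_lattice[of x] abs_lattice[of "d *\<^sub>R x"] scaleR_sup[OF that])
  show ?thesis
    using *[of c] *[of "- c"] by (cases "0 \<le> c") auto
qed

text \<open>The common factor \<open>1 + c\<close> dominates both \<open>1\<close> and
  \<open>c\<close>, so the pair lies below a scaled copy of the disjoint pair.\<close>

lemma disjoint_scaleR: "inf x (c *\<^sub>R y) = 0"
  if "inf x y = 0" "0 \<le> x" "0 \<le> y" "0 \<le> c"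
  for x y :: "'a::{lattice_ab_group_add, ordered_real_vector}"
proof -
  have "(1 + c) *\<^sub>R inf x y = inf ((1 + c) *\<^sub>R x) ((1 + c) *\<^sub>R y)"
    using that by (intro scaleR_inf) simp
  then have "inf ((1 + c) *\<^sub>R x) ((1 + c) *\<^sub>R y) = 0"
    using \<open>inf x y = 0\<close> by simp
  moreover have "x \<le> (1 + c) *\<^sub>R x" "c *\<^sub>R y \<le> (1 + c) *\<^sub>R y"
    using that by (simp_all add: scaleR_left_distrib scaleR_nonneg_nonneg)
  ultimately show ?thesis
    using that by (blast intro: disjoint_mono scaleR_nonneg_nonneg)
qed

text \<open>\<open>y - (1 / c) *\<^sub>R x\<close> is a negative multiple of
  \<open>x - c *\<^sub>R y\<close>, so up to scaling these are the positive and negative part of one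
  element. This is the source of disjointness in \<open>approximately_order_bounded\<close>.\<close>

lemma disjoint_pprt_diff_scaleR: "inf (pprt (x - c *\<^sub>R y)) (pprt (y - (1 / c) *\<^sub>R x)) = 0"
  if "c > 0" for x y :: "'a::{lattice_ab_group_add, ordered_real_vector}"
proof -
  have "inf (pprt (x - c *\<^sub>R y)) ((1 / c) *\<^sub>R pprt (- (x - c *\<^sub>R y))) = 0"
    using that by (intro disjoint_scaleR inf_pprt_pprt_minus zero_le_pprt) simp
  moreover have "(1 / c) *\<^sub>R pprt (- (x - c *\<^sub>R y)) = pprt (y - (1 / c) *\<^sub>R x)"
    using that by (simp add: scaleR_pprt scaleR_diff_right)
  ultimately show ?thesis
    by (simp only:)
qed

text \<open>With \<open>?A\<close> and \<open>?B\<close> the sums of the positive and of the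
  negative parts, \<open>x + y = ?A - ?B\<close>, so the defect is exactly \<open>inf ?A ?B\<close>.
  For numbers the left-hand side is positive only if zero lies strictly between \<open>x\<close> and
  \<open>y\<close>; after a shift by \<open>t u\<close> it detects that the level \<open>t u\<close>
  separates them.\<close>

lemma inf_pprt_le_convexity_defect:
  "inf (pprt (sup x y)) (pprt (- inf x y)) \<le> pprt x + pprt y - pprt (x + y)"
  for x y :: "'a::lattice_ab_group_add"
proof -
  let ?A = "pprt x + pprt y" and ?B = "pprt (- x) + pprt (- y)"
  have "x + y = ?A - ?B"
    using pprt_diff_pprt_minus[of x] pprt_diff_pprt_minus[of y] by (simp add: algebra_simps)
  then have "?A - pprt (x + y) = inf ?A ?B"
    using inf_plus_pprt_diff[of ?A ?B] by (metis add_diff_cancel_right')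
  moreover have "inf (pprt (sup x y)) (pprt (- inf x y)) \<le> inf ?A ?B"
    using pprt_sup_le[of x y] pprt_sup_le[of "- x" "- y"] by (intro inf_mono) simp_all
  ultimately show ?thesis by simp
qed

section \<open>Truncation to an order interval\<close>

definition clip :: "'a::lattice_ab_group_add \<Rightarrow> 'a \<Rightarrow> 'a"
  where "clip u x = sup (inf x u) (- u)"

lemma clip_mono: "x \<le> y \<Longrightarrow> clip u x \<le> clip u y"
  unfolding clip_def by (meson inf_mono order_refl sup_mono)

lemma clip_eq: "- u \<le> x \<Longrightarrow> x \<le> u \<Longrightarrow> clip u x = x"
  by (simp add: clip_def inf_absorb1 sup_absorb1)

lemma abs_clip_le: "\<bar>clip u x\<bar> \<le> u" if "0 \<le> u"
  for u x :: "'a::lattice_ab_group_add_abs"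
proof (rule abs_leI)
  have "- u \<le> u"
    using that by (simp add: minus_le_self_iff)
  then show "clip u x \<le> u"
    by (simp add: clip_def)
  have "- u \<le> clip u x"
    by (simp add: clip_def)
  then show "- clip u x \<le> u"
    by (simp add: minus_le_iff)
qed

lemma clip_diff_le: "clip u y - clip u x \<le> y - x" if "x \<le> y"
  for u x y :: "'a::lattice_ab_group_add"
proof -
  from that have d: "0 \<le> y - x" by simp
  have "inf y u \<le> inf (x + (y - x)) (u + (y - x))"
    using d by (intro inf_mono) (simp_all add: add_increasing2)
  then have 1: "inf y u \<le> inf x u + (y - x)"
    by (simp only: add_inf_distrib_right)
  have "clip u y \<le> sup (inf x u + (y - x)) (- u + (y - x))"
    unfolding clip_def using 1 d by (intro sup_mono) (simp_all only: le_add_same_cancel1)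
  also have "\<dots> = clip u x + (y - x)"
    by (simp only: clip_def add_sup_distrib_right)
  finally show ?thesis
    by (simp only: diff_le_eq add.commute)
qed

lemma abs_diff_clip_le: "\<bar>x - clip u x\<bar> \<le> pprt (\<bar>x\<bar> - u)"
  for u x :: "'a::lattice_ab_group_add_abs"
proof (rule abs_leI)
  have "x - clip u x \<le> x - inf x u"
    unfolding clip_def by (intro diff_left_mono) simp
  also have "\<dots> = pprt (x - u)"
    using inf_plus_pprt_diff[of x u] by (metis add_diff_cancel_left')
  also have "\<dots> \<le> pprt (\<bar>x\<bar> - u)"
    by (intro pprt_mono diff_right_mono abs_ge_self)
  finally show "x - clip u x \<le> pprt (\<bar>x\<bar> - u)" .
  have "clip u x \<le> sup x (- u)"
    unfolding clip_def by (intro sup_mono) auto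
  also have "\<dots> = x + pprt (- x - u)"
    by (simp add: pprt_def add_sup_distrib_left sup_commute)
  also have "\<dots> \<le> x + pprt (\<bar>x\<bar> - u)"
    by (intro add_left_mono pprt_mono diff_right_mono abs_ge_minus_self)
  finally show "- (x - clip u x) \<le> pprt (\<bar>x\<bar> - u)"
    by (simp add: algebra_simps)
qed

text \<open>Replaces \<open>x\<close> and \<open>y\<close>, which may be incomparable, by
  \<open>inf x y \<le> sup x y\<close>, the form in which the grid estimate applies.\<close>

lemma abs_diff_clip_clip_le: "\<bar>clip u x - clip u y\<bar> \<le> clip u (sup x y) - clip u (inf x y)"
  for u x y :: "'a::lattice_ab_group_add_abs"
proof -
  have "clip u x \<le> clip u (sup x y)" "clip u y \<le> clip u (sup x y)"
    "clip u (inf x y) \<le> clip u x" "clip u (inf x y) \<le> clip u y"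
    by (simp_all add: clip_mono)
  then show ?thesis
    by (intro abs_leI) (simp_all only: minus_diff_eq diff_mono)
qed

text \<open>Truncating \<open>z\<close> at \<open>\<bar>x\<bar>\<close> gives the first part; what
  is cut off is at most the excess of \<open>\<bar>z\<bar>\<close> over
  \<open>\<bar>x\<bar>\<close>, hence at most \<open>\<bar>y\<bar>\<close>.\<close>

lemma riesz_decomposition:
  fixes x y z :: "'a::lattice_ab_group_add_abs"
  assumes "\<bar>z\<bar> \<le> \<bar>x\<bar> + \<bar>y\<bar>"
  obtains z1 z2 where "z = z1 + z2" "\<bar>z1\<bar> \<le> \<bar>x\<bar>" "\<bar>z2\<bar> \<le> \<bar>y\<bar>"
proof
  show "z = clip \<bar>x\<bar> z + (z - clip \<bar>x\<bar> z)" by simp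
  show "\<bar>clip \<bar>x\<bar> z\<bar> \<le> \<bar>x\<bar>" by (rule abs_clip_le) simp
  have "pprt (\<bar>z\<bar> - \<bar>x\<bar>) \<le> \<bar>y\<bar>"
    using assms by (simp add: pprt_le_iff algebra_simps)
  then show "\<bar>z - clip \<bar>x\<bar> z\<bar> \<le> \<bar>y\<bar>"
    using abs_diff_clip_le order_trans by blast
qed

text \<open>
  Pointwise, if \<open>y - x\<close> exceeds the mesh, then some grid level lies well inside the interval from
  \<open>x\<close> to \<open>y\<close>. The induction on the levels replaces the choice of that level.
\<close>

lemma clip_diff_le_grid:
  fixes x y u :: "'a::{lattice_ab_group_add_abs, ordered_real_vector}"
  assumes "x \<le> y" "0 \<le> u" "t 0 = -1" "t k = 1" and mesh: "\<And>j. t (Suc j) - t j \<le> h" and "0 \<le> h"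
  shows "clip u y - clip u x
    \<le> h *\<^sub>R u + 2 *\<^sub>R (\<Sum>j\<le>k. inf (pprt (y - t j *\<^sub>R u)) (pprt (t j *\<^sub>R u - x)))"
proof -
  define p where "p j = pprt (y - t j *\<^sub>R u)" for j
  define r where "r j = pprt (t j *\<^sub>R u - x)" for j
  define V where "V = (\<Sum>j\<le>k. inf (p j) (r j))"
  \<comment> \<open>The factor 1/2 pays for the bound by two copies of a supremum in
    \<open>ss\<close>; the claim becomes \<open>s \<le> V\<close>.\<close>
  define s where "s = (1/2) *\<^sub>R (clip u y - clip u x - h *\<^sub>R u)"
  have pr: "0 \<le> p j" "0 \<le> r j" for j
    by (simp_all add: p_def r_def)
  have V: "inf (p j) (r j) \<le> V" if "j \<le> k" for j
    unfolding V_def using sum_mono2[of "{..k}" "{j}" "\<lambda>j. inf (p j) (r j)"] that pr by simp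
  have s_le: "s \<le> z" if "clip u y - clip u x - h *\<^sub>R u \<le> z" "0 \<le> z" for z
  proof -
    have "s \<le> (1/2) *\<^sub>R z"
      unfolding s_def using that by (intro scaleR_left_mono) auto
    also have "\<dots> \<le> z"
      using scaleR_right_mono[of "1/2" 1 z] that by simp
    finally show ?thesis .
  qed
  have hu: "0 \<le> h *\<^sub>R u"
    using \<open>0 \<le> h\<close> \<open>0 \<le> u\<close> by (rule scaleR_nonneg_nonneg)
  have diff: "clip u y - clip u x - h *\<^sub>R u \<le> clip u y - clip u x"
    using hu by simp
  have s0: "s \<le> p 0"
  proof (rule s_le)
    have "- u \<le> clip u x"
      by (simp add: clip_def)
    then have "clip u y - clip u x \<le> clip u y + u"
      using diff_left_mono[of "- u" "clip u x" "clip u y"] by simp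
    also have "\<dots> = sup (inf y u + u) 0"
      by (simp add: clip_def add_sup_distrib_right)
    also have "\<dots> \<le> p 0"
      using \<open>t 0 = -1\<close> unfolding p_def pprt_def by (intro sup_mono) (auto intro: add_right_mono)
    finally show "clip u y - clip u x - h *\<^sub>R u \<le> p 0"
      using diff by (rule order_trans[rotated])
  qed (rule pr)
  have sk: "s \<le> r k"
  proof (rule s_le)
    have "clip u y \<le> u"
      using \<open>0 \<le> u\<close> by (simp add: clip_def minus_le_self_iff)
    then have "clip u y - clip u x \<le> u - clip u x"
      by (rule diff_right_mono)
    also have "\<dots> \<le> u - inf x u"
      unfolding clip_def by (intro diff_left_mono) simp
    also have "\<dots> = r k"
      using inf_plus_pprt_diff[of u x] \<open>t k = 1\<close>
      by (simp add: r_def inf_commute[of x u] diff_eq_eq add.commute del: diff_inf_eq_sup)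
    finally show "clip u y - clip u x - h *\<^sub>R u \<le> r k"
      using diff by (rule order_trans[rotated])
  qed (rule pr)
  \<comment> \<open>If \<open>x\<close> is above level \<open>j\<close> and \<open>y\<close> below
    level \<open>j + 1\<close>, they differ by at most the mesh; in general the difference exceeds
    the mesh by at most \<open>r j + p (Suc j)\<close>.\<close>
  have ss: "s \<le> sup (r j) (p (Suc j))" for j
  proof -
    have "clip u y - clip u x - h *\<^sub>R u \<le> (y - x) - h *\<^sub>R u"
      using clip_diff_le[OF \<open>x \<le> y\<close>, of u] by (rule diff_right_mono)
    also have "\<dots> \<le> (y - x) - (t (Suc j) - t j) *\<^sub>R u"
      using mesh[of j] \<open>0 \<le> u\<close> by (intro diff_left_mono scaleR_right_mono)
    also have "\<dots> = (t j *\<^sub>R u - x) + (y - t (Suc j) *\<^sub>R u)"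
      by (simp add: algebra_simps)
    also have "\<dots> \<le> sup (r j) (p (Suc j)) + sup (r j) (p (Suc j))"
      unfolding r_def p_def by (intro add_mono le_supI1[OF le_pprt] le_supI2[OF le_pprt])
    finally have "s \<le> (1/2) *\<^sub>R (sup (r j) (p (Suc j)) + sup (r j) (p (Suc j)))"
      unfolding s_def by (intro scaleR_left_mono) auto
    then show ?thesis
      by (simp flip: scaleR_2)
  qed
  \<comment> \<open>A resolution step: \<open>p j\<close> and \<open>r j\<close> act as opposite
    literals, and their conflict \<open>inf (p j) (r j)\<close> is absorbed by
    \<open>V\<close>.\<close>
  have step: "s \<le> sup V z" if "s \<le> sup V (p j)" "s \<le> sup (r j) z" "j \<le> k" for j z
  proof -
    have "inf (p j) (sup (r j) z) \<le> sup (inf (r j) (p j)) (inf z (p j))"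
      unfolding inf_commute[of "p j" "sup (r j) z"] by (rule inf_sup_le_distrib)
    also have "\<dots> \<le> sup V z"
      using V[OF that(3)] unfolding inf_commute[of "p j" "r j"]
      by (rule sup_mono) (rule inf_le1)
    finally have "sup (inf V (sup (r j) z)) (inf (p j) (sup (r j) z)) \<le> sup V z"
      by (rule le_supI[rotated]) (rule le_infI1[OF sup_ge1])
    moreover have "s \<le> inf (sup V (p j)) (sup (r j) z)"
      using that by (intro le_infI)
    ultimately show ?thesis
      using inf_sup_le_distrib[of V "p j" "sup (r j) z"] order_trans by blast
  qed
  have "s \<le> sup V (p j)" if "j \<le> k" for j
    using that
  proof (induction j)
    case 0
    show ?case using s0 by (rule le_supI2)
  next
    case (Suc j)
    then have j: "j \<le> k" by simp
    show ?case by (rule step[OF Suc.IH[OF j] ss j])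
  qed
  then have "s \<le> sup V V"
    using step[of k V] sk le_supI1 by blast
  then have "s \<le> V" by simp
  then have "2 *\<^sub>R s \<le> 2 *\<^sub>R V"
    by (rule scaleR_left_mono) simp
  moreover have "2 *\<^sub>R s = clip u y - clip u x - h *\<^sub>R u"
    by (simp add: s_def)
  ultimately have "clip u y - clip u x - h *\<^sub>R u \<le> 2 *\<^sub>R V"
    by (simp only:)
  then have "clip u y - clip u x \<le> 2 *\<^sub>R V + h *\<^sub>R u"
    by (rule diff_le_eq[THEN iffD1])
  also have "\<dots> = h *\<^sub>R u + 2 *\<^sub>R V"
    by (rule add.commute)
  finally show ?thesis
    by (simp only: V_def p_def r_def)
qed

section \<open>The Hahn--Banach theorem\<close>

definition sublinear :: "('a::real_vector \<Rightarrow> real) \<Rightarrow> bool"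
  where "sublinear p \<longleftrightarrow>
    (\<forall>x y. p (x + y) \<le> p x + p y) \<and> (\<forall>c x. 0 < c \<longrightarrow> p (c *\<^sub>R x) = c * p x)"

lemma sublinear_add: "sublinear p \<Longrightarrow> p (x + y) \<le> p x + p y"
  by (simp add: sublinear_def)

lemma sublinear_scaleR_pos: "sublinear p \<Longrightarrow> 0 < c \<Longrightarrow> p (c *\<^sub>R x) = c * p x"
  by (simp add: sublinear_def)

lemma sublinear_zero: "p 0 = 0" if "sublinear p"
  using sublinear_scaleR_pos[OF that, of 2 0] by simp

lemma sublinear_scaleR: "p (c *\<^sub>R x) = c * p x" if "sublinear p" "0 \<le> c"
  using that sublinear_zero[of p] sublinear_scaleR_pos[of p c x] by (cases "c = 0") auto

lemma sublinear_minus: "- p (- x) \<le> p x" if "sublinear p"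
  using sublinear_add[OF that, of x "- x"] sublinear_zero[OF that] by simp

lemma sublinearI:
  assumes add: "\<And>x y. p (x + y) \<le> p x + p y"
    and scale: "\<And>c x. 0 < c \<Longrightarrow> p (c *\<^sub>R x) \<le> c * p x"
  shows "sublinear p"
  unfolding sublinear_def
proof (intro conjI allI impI antisym)
  fix c :: real and x
  assume c: "0 < c"
  then show "p (c *\<^sub>R x) \<le> c * p x"
    by (rule scale)
  have "p (inverse c *\<^sub>R (c *\<^sub>R x)) \<le> inverse c * p (c *\<^sub>R x)"
    using c by (intro scale) simp
  then show "c * p x \<le> p (c *\<^sub>R x)"
    using c by (simp add: field_simps)
qed (rule add)

text \<open>
  The largest sublinear functional below \<open>p\<close> that takes the value \<open>- p y\<close> at \<open>- y\<close>. A minimal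
  sublinear functional agrees with all of these, which makes it additive.
\<close>

definition sublinear_shift :: "('a::real_vector \<Rightarrow> real) \<Rightarrow> 'a \<Rightarrow> 'a \<Rightarrow> real"
  where "sublinear_shift p y x = (INF t\<in>{0..}. p (x + t *\<^sub>R y) - t * p y)"

context
  fixes p :: "'a::real_vector \<Rightarrow> real"
  assumes p: "sublinear p"
begin

lemma sublinear_shift_le: "sublinear_shift p y x \<le> p (x + t *\<^sub>R y) - t * p y" if "0 \<le> t"
  unfolding sublinear_shift_def
proof (rule cINF_lower)
  \<comment> \<open>Subadditivity bounds \<open>t * p y = p (t *\<^sub>R y)\<close> by
    \<open>p (x + t *\<^sub>R y) + p (- x)\<close>.\<close>
  show "bdd_below ((\<lambda>t. p (x + t *\<^sub>R y) - t * p y) ` {0..})"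
  proof (rule bdd_belowI2)
    fix t :: real assume "t \<in> {0..}"
    then show "- p (- x) \<le> p (x + t *\<^sub>R y) - t * p y"
      using sublinear_add[OF p, of "x + t *\<^sub>R y" "- x"] sublinear_scaleR[OF p, of t y] by simp
  qed
qed (use that in simp)

lemma le_sublinear_shift:
  "(\<And>t. 0 \<le> t \<Longrightarrow> c \<le> p (x + t *\<^sub>R y) - t * p y) \<Longrightarrow> c \<le> sublinear_shift p y x"
  unfolding sublinear_shift_def by (rule cINF_greatest) auto

lemma sublinear_sublinear_shift: "sublinear (sublinear_shift p y)"
proof (rule sublinearI)
  fix x z
  have "sublinear_shift p y (x + z) - (p (z + t *\<^sub>R y) - t * p y) \<le> sublinear_shift p y x"
    if "0 \<le> t" for t
  proof (rule le_sublinear_shift)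
    fix s :: real assume "0 \<le> s"
    then show "sublinear_shift p y (x + z) - (p (z + t *\<^sub>R y) - t * p y)
        \<le> p (x + s *\<^sub>R y) - s * p y"
      using sublinear_shift_le[of "s + t" y "x + z"] that
        sublinear_add[OF p, of "x + s *\<^sub>R y" "z + t *\<^sub>R y"]
      by (simp add: algebra_simps)
  qed
  then have "sublinear_shift p y (x + z) - sublinear_shift p y x \<le> sublinear_shift p y z"
    by (intro le_sublinear_shift) (simp add: algebra_simps)
  then show "sublinear_shift p y (x + z) \<le> sublinear_shift p y x + sublinear_shift p y z"
    by simp
next
  fix c :: real and x assume c: "0 < c"
  have "sublinear_shift p y (c *\<^sub>R x) / c \<le> sublinear_shift p y x"
  proof (rule le_sublinear_shift)
    fix t :: real assume "0 \<le> t"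
    then have "sublinear_shift p y (c *\<^sub>R x) \<le> p (c *\<^sub>R (x + t *\<^sub>R y)) - (c * t) * p y"
      using c sublinear_shift_le[of "c * t" y "c *\<^sub>R x"] by (simp add: scaleR_right_distrib)
    also have "\<dots> = c * (p (x + t *\<^sub>R y) - t * p y)"
      by (simp only: sublinear_scaleR_pos[OF p c] right_diff_distrib mult.assoc)
    finally show "sublinear_shift p y (c *\<^sub>R x) / c \<le> p (x + t *\<^sub>R y) - t * p y"
      using c by (simp add: divide_le_eq mult.commute)
  qed
  then show "sublinear_shift p y (c *\<^sub>R x) \<le> c * sublinear_shift p y x"
    using c by (simp add: divide_le_eq mult.commute)
qed

text \<open>Zorn's lemma downwards. Every sublinear minorant stays above \<open>- p (- x)\<close>,
  so a chain has a pointwise infimum, and this is subadditive because any two members of the chain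
  have one of them below both.\<close>

lemma exists_minimal_sublinear:
  obtains m where "sublinear m" "m \<le> p" "\<And>r. sublinear r \<Longrightarrow> r \<le> m \<Longrightarrow> r = m"
proof -
  define A where "A = {r. sublinear r \<and> r \<le> p}"
  have "\<exists>m\<in>A. \<forall>a\<in>A. m \<ge> a \<longrightarrow> a = m"
  proof (rule predicate_Zorn)
    show "partial_order_on A (relation_of (\<ge>) A)"
      by (rule partial_order_on_relation_ofI) auto
  next
    fix C assume C: "C \<in> Chains (relation_of (\<ge>) A)"
    then have sub: "r \<in> A" if "r \<in> C" for r
      using that by (auto simp: Chains_def relation_of_def)
    show "\<exists>u\<in>A. \<forall>a\<in>C. a \<ge> u"
    proof (cases "C = {}")
      case True
      then show ?thesis using p by (intro bexI[of _ p]) (auto simp: A_def)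
    next
      case False
      define u where "u x = (INF r\<in>C. r x)" for x
      have u_le: "u x \<le> r x" if "r \<in> C" for r x
        unfolding u_def
      proof (rule cINF_lower)
        show "bdd_below ((\<lambda>r. r x) ` C)"
        proof (rule bdd_belowI2)
          fix r assume "r \<in> C"
          then have r: "sublinear r" "r \<le> p"
            using sub by (auto simp: A_def)
          then have "r (- x) \<le> p (- x)" by (simp add: le_fun_def)
          then show "- p (- x) \<le> r x"
            using sublinear_minus[OF r(1), of x] by simp
        qed
      qed (rule that)
      have le_u: "c \<le> u x" if "\<And>r. r \<in> C \<Longrightarrow> c \<le> r x" for c x
        unfolding u_def using False that by (rule cINF_greatest)
      have "sublinear u"
      proof (rule sublinearI)
        fix x y
        have "u (x + y) \<le> r x + s y" if rs: "r \<in> C" "s \<in> C" for r s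
        proof -
          have "(r, s) \<in> relation_of (\<ge>) A \<or> (s, r) \<in> relation_of (\<ge>) A"
            using C rs unfolding Chains_def by blast
          then obtain w where w: "w \<in> C" "w \<le> r" "w \<le> s"
            using rs by (auto simp: relation_of_def)
          have "sublinear w" using sub w(1) by (auto simp: A_def)
          then show ?thesis
            using u_le[OF w(1), of "x + y"] sublinear_add[of w x y] w(2,3)
              le_funD[of w r x] le_funD[of w s y] by simp
        qed
        then have "u (x + y) - s y \<le> u x" if "s \<in> C" for s
          using that by (intro le_u) (simp add: diff_le_eq)
        then have "u (x + y) - u x \<le> u y"
          by (intro le_u) (simp add: algebra_simps)
        then show "u (x + y) \<le> u x + u y" by simp
      next
        fix c :: real and x assume c: "0 < c"
        have "u (c *\<^sub>R x) / c \<le> u x"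
        proof (rule le_u)
          fix r assume r: "r \<in> C"
          then have "sublinear r" using sub by (auto simp: A_def)
          then have "u (c *\<^sub>R x) \<le> c * r x"
            using u_le[OF r, of "c *\<^sub>R x"] c by (simp add: sublinear_scaleR_pos)
          then show "u (c *\<^sub>R x) / c \<le> r x"
            using c by (simp add: divide_le_eq mult.commute)
        qed
        then show "u (c *\<^sub>R x) \<le> c * u x"
          using c by (simp add: divide_le_eq mult.commute)
      qed
      moreover obtain r where "r \<in> C" using False by blast
      then have "u \<le> p"
        using u_le[of r] sub[of r] by (auto simp: A_def le_fun_def intro: order_trans)
      ultimately show ?thesis
        using u_le by (intro bexI[of _ u]) (auto simp: A_def le_fun_def)
    qed
  qed
  then obtain m where m: "m \<in> A" "\<And>a. a \<in> A \<Longrightarrow> a \<le> m \<Longrightarrow> a = m"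
    by blast
  show thesis
  proof (rule that)
    show "r = m" if "sublinear r" "r \<le> m" for r
      using that m(1) by (intro m(2)) (auto simp: A_def)
  qed (use m(1) in \<open>auto simp: A_def\<close>)
qed

end

lemma linear_below_sublinear:
  fixes p :: "'a::real_vector \<Rightarrow> real"
  assumes p: "sublinear p"
  obtains f where "linear f" "\<And>x. f x \<le> p x"
proof -
  obtain m where m: "sublinear m" "m \<le> p" and min: "\<And>r. sublinear r \<Longrightarrow> r \<le> m \<Longrightarrow> r = m"
    using exists_minimal_sublinear[OF p] by blast
  have eq: "sublinear_shift m y = m" for y
    using sublinear_shift_le[OF m(1), of 0]
    by (intro min sublinear_sublinear_shift m(1)) (simp add: le_fun_def)
  \<comment> \<open>Since the shift of \<open>m\<close> is \<open>m\<close> itself, the parameter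
    \<open>t = 1\<close> gives \<open>m x \<le> m (x + y) - m y\<close>, the reverse of
    subadditivity.\<close>
  have add: "m (x + y) = m x + m y" for x y
    using sublinear_shift_le[OF m(1), of 1 y x] sublinear_add[OF m(1), of x y]
    by (simp add: eq)
  have minus: "m (- x) = - m x" for x
    using add[of x "- x"] sublinear_zero[OF m(1)] by simp
  have "m (c *\<^sub>R x) = c *\<^sub>R m x" for c x
    using sublinear_scaleR[OF m(1), of c x] sublinear_scaleR[OF m(1), of "- c" x] minus[of "c *\<^sub>R x"]
    by (cases "0 \<le> c") auto
  with add have "linear m"
    by (intro linearI) auto
  then show thesis
    using m(2) that by (auto simp: le_fun_def)
qed

text \<open>Minorizing \<open>sublinear_shift p x0\<close> instead of \<open>p\<close> forces
  equality at \<open>x0\<close>: the shift is at most \<open>- p x0\<close> at \<open>- x0\<close>,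
  and its parameter \<open>t = 0\<close> shows that it lies below \<open>p\<close>.\<close>

theorem hahn_banach:
  fixes p :: "'a::real_vector \<Rightarrow> real"
  assumes p: "sublinear p"
  obtains f where "linear f" "\<And>x. f x \<le> p x" "f x0 = p x0"
proof -
  obtain f where f: "linear f" "\<And>x. f x \<le> sublinear_shift p x0 x"
    using linear_below_sublinear[OF sublinear_sublinear_shift[OF p]] by blast
  have le: "f x \<le> p x" for x
    using f(2)[of x] sublinear_shift_le[OF p, of 0 x0 x] by simp
  have "- f x0 = f (- x0)"
    using f(1) by (simp add: linear_neg)
  also have "\<dots> \<le> sublinear_shift p x0 (- x0)"
    by (rule f(2))
  also have "\<dots> \<le> - p x0"
    using sublinear_shift_le[OF p, of 1 x0 "- x0"] sublinear_zero[OF p] by simp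
  finally have "f x0 = p x0"
    using le[of x0] by simp
  with f(1) le show thesis
    using that by blast
qed

corollary hahn_banach_blinfun:
  fixes p :: "'a::real_normed_vector \<Rightarrow> real"
  assumes p: "sublinear p" and bound: "\<And>x. p x \<le> K * norm x" and "0 \<le> K"
  obtains f :: "'a \<Rightarrow>\<^sub>L real" where "\<And>x. blinfun_apply f x \<le> p x" "blinfun_apply f x0 = p x0" "norm f \<le> K"
proof -
  obtain f where f: "linear f" "\<And>x. f x \<le> p x" "f x0 = p x0"
    using hahn_banach[OF p] by blast
  have *: "norm (f x) \<le> norm x * K" for x
    using f(2)[of x] f(2)[of "- x"] bound[of x] bound[of "- x"] f(1)
    by (auto simp: linear_neg abs_le_iff mult.commute)
  then have "bounded_linear f"
    using f(1) by (intro bounded_linear.intro bounded_linear_axioms.intro) auto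
  then have app: "blinfun_apply (Blinfun f) x = f x" for x
    by (simp add: bounded_linear_Blinfun_apply)
  show thesis
  proof (rule that[of "Blinfun f"])
    show "norm (Blinfun f) \<le> K"
      using * \<open>0 \<le> K\<close> by (intro norm_blinfun_bound) (auto simp: app mult.commute)
  qed (use f in \<open>auto simp: app\<close>)
qed

lemma sublinear_norm: "sublinear norm"
  by (rule sublinearI) (simp_all add: norm_triangle_ineq)

lemma exists_norming_functional:
  fixes x :: "'a::real_normed_vector"
  obtains g :: "'a \<Rightarrow>\<^sub>L real" where "norm g \<le> 1" "blinfun_apply g x = norm x"
  using hahn_banach_blinfun[OF sublinear_norm, of 1 x] by auto

section \<open>Positive functionals and the bidual\<close>

lemma bidual_embedding_le_iff:
  "bidual_embedding x \<le> \<Phi> \<longleftrightarrow> (\<forall>f\<ge>0. blinfun_apply f x \<le> blinfun_apply \<Phi> f)"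
  by (simp add: less_eq_blinfun_def)

lemma le_bidual_embedding_iff:
  "\<Phi> \<le> bidual_embedding x \<longleftrightarrow> (\<forall>f\<ge>0. blinfun_apply \<Phi> f \<le> blinfun_apply f x)"
  by (simp add: less_eq_blinfun_def)

lemma blinfun_nonneg: "0 \<le> f \<Longrightarrow> 0 \<le> x \<Longrightarrow> 0 \<le> blinfun_apply f x"
  for f :: "'a::{real_normed_vector, preorder} \<Rightarrow>\<^sub>L real"
  by (simp add: less_eq_blinfun_def)

lemma blinfun_mono: "0 \<le> f \<Longrightarrow> x \<le> y \<Longrightarrow> blinfun_apply f x \<le> blinfun_apply f y"
  for f :: "'a::banach_lattice \<Rightarrow>\<^sub>L real"
  using blinfun_nonneg[of f "y - x"] by (simp add: blinfun.diff_right)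

lemma norm_mono_nonneg: "0 \<le> x \<Longrightarrow> x \<le> y \<Longrightarrow> norm x \<le> norm y"
  for x y :: "'a::banach_lattice"
  using order_trans[of 0 x y] by (intro norm_lattice_mono) simp

lemma norm_pprt_le: "norm (pprt x) \<le> norm x"
  for x :: "'a::banach_lattice"
  by (intro norm_lattice_mono abs_pprt_le)

lemma sublinear_pprt:
  fixes q :: "'a::{lattice_ab_group_add, ordered_real_vector} \<Rightarrow> real"
  assumes mono: "\<And>x y. 0 \<le> x \<Longrightarrow> x \<le> y \<Longrightarrow> q x \<le> q y"
    and add: "\<And>x y. 0 \<le> x \<Longrightarrow> 0 \<le> y \<Longrightarrow> q (x + y) \<le> q x + q y"
    and scale: "\<And>c x. 0 < c \<Longrightarrow> 0 \<le> x \<Longrightarrow> q (c *\<^sub>R x) \<le> c * q x"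
  shows "sublinear (\<lambda>x. q (pprt x))"
proof (rule sublinearI)
  fix x y :: 'a
  have "q (pprt (x + y)) \<le> q (pprt x + pprt y)"
    by (intro mono zero_le_pprt pprt_add_le)
  also have "\<dots> \<le> q (pprt x) + q (pprt y)"
    by (intro add zero_le_pprt)
  finally show "q (pprt (x + y)) \<le> q (pprt x) + q (pprt y)" .
next
  fix c :: real and x :: 'a assume "0 < c"
  then show "q (pprt (c *\<^sub>R x)) \<le> c * q (pprt x)"
    using scale[of c "pprt x"] by (simp add: scaleR_pprt)
qed

text \<open>The sublinear functional vanishes on the negative cone, so its linear minorants are positive.\<close>

lemma exists_positive_functional:
  fixes q :: "'a::banach_lattice \<Rightarrow> real"
  assumes mono: "\<And>x y. 0 \<le> x \<Longrightarrow> x \<le> y \<Longrightarrow> q x \<le> q y"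
    and add: "\<And>x y. 0 \<le> x \<Longrightarrow> 0 \<le> y \<Longrightarrow> q (x + y) \<le> q x + q y"
    and scale: "\<And>c x. 0 < c \<Longrightarrow> 0 \<le> x \<Longrightarrow> q (c *\<^sub>R x) \<le> c * q x"
    and bound: "\<And>x. 0 \<le> x \<Longrightarrow> q x \<le> K * norm x" and "0 \<le> K"
  obtains f :: "'a \<Rightarrow>\<^sub>L real"
  where "0 \<le> f" "\<And>x. 0 \<le> x \<Longrightarrow> blinfun_apply f x \<le> q x" "blinfun_apply f z = q (pprt z)" "norm f \<le> K"
proof -
  have p: "sublinear (\<lambda>x. q (pprt x))"
    using mono add scale by (rule sublinear_pprt)
  have "q (pprt x) \<le> K * norm x" for x
    using bound[of "pprt x"] mult_left_mono[OF norm_pprt_le[of x] \<open>0 \<le> K\<close>] by simp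
  from hahn_banach_blinfun[OF p this \<open>0 \<le> K\<close>]
  obtain f :: "'a \<Rightarrow>\<^sub>L real"
    where f: "\<And>x. blinfun_apply f x \<le> q (pprt x)" "blinfun_apply f z = q (pprt z)" "norm f \<le> K"
    by metis
  have "q 0 = 0"
    using sublinear_zero[OF p] by simp
  then have "0 \<le> blinfun_apply f x" if "0 \<le> x" for x
    using that f(1)[of "- x"] by (simp add: blinfun.minus_right)
  then show thesis
    using f(2,3) f(1) that[of f] by (simp add: less_eq_blinfun_def) (metis pprt_eq_id)
qed

text \<open>The Riesz-Kantorovich formula: a positive \<open>f\<close> splits into positive
  \<open>g\<close> and \<open>f - g\<close> with \<open>f (sup x y) = g x + (f - g) y\<close>, and
  \<open>\<Phi>\<close> bounds each summand. Hahn-Banach yields \<open>g\<close>, dominated by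
  \<open>f\<close> on the cone, with \<open>g (x - y) = f (pprt (x - y))\<close>.\<close>

lemma bidual_embedding_sup_le:
  fixes x y :: "'a::banach_lattice"
  assumes "bidual_embedding x \<le> \<Phi>" "bidual_embedding y \<le> \<Phi>"
  shows "bidual_embedding (sup x y) \<le> \<Phi>"
  unfolding bidual_embedding_le_iff
proof (intro allI impI)
  fix f :: "'a \<Rightarrow>\<^sub>L real" assume f: "0 \<le> f"
  obtain g where g: "0 \<le> g" "\<And>z. 0 \<le> z \<Longrightarrow> blinfun_apply g z \<le> blinfun_apply f z"
    "blinfun_apply g (x - y) = blinfun_apply f (pprt (x - y))"
  proof (rule exists_positive_functional[of "blinfun_apply f" "norm f"])
    show "blinfun_apply f z \<le> norm f * norm z" for z
      using norm_blinfun[of f z] by simp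
  qed (use f in \<open>auto simp: blinfun.add_right blinfun.scaleR_right blinfun_mono\<close>)
  have fg: "0 \<le> f - g"
    using g(2) by (simp add: less_eq_blinfun_def blinfun.diff_left)
  have "sup x y = y + pprt (x - y)"
    by (simp add: pprt_def add_sup_distrib_left)
  then have "blinfun_apply f (sup x y) = blinfun_apply g x + blinfun_apply (f - g) y"
    using g(3) by (simp add: blinfun.add_right blinfun.diff_right blinfun.diff_left)
  also have "\<dots> \<le> blinfun_apply \<Phi> g + blinfun_apply \<Phi> (f - g)"
    using assms g(1) fg by (intro add_mono) (simp_all add: bidual_embedding_le_iff)
  also have "\<dots> = blinfun_apply \<Phi> f"
    by (simp add: blinfun.diff_right)
  finally show "blinfun_apply f (sup x y) \<le> blinfun_apply \<Phi> f" .
qed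

lemma bidual_embedding_mono: "x \<le> y \<Longrightarrow> bidual_embedding x \<le> bidual_embedding y"
  for x y :: "'a::banach_lattice"
  by (simp add: less_eq_blinfun_def blinfun_mono)

text \<open>A positive functional of norm at most one that attains the norm at \<open>x\<close>
  turns the order bound into a norm bound, so only the operator norm of \<open>\<Phi>\<close>
  enters.\<close>

lemma norm_le_if_bidual_embedding_le:
  fixes x :: "'a::banach_lattice"
  assumes "0 \<le> x" "bidual_embedding x \<le> \<Phi>"
  shows "norm x \<le> norm \<Phi>"
proof -
  obtain f :: "'a \<Rightarrow>\<^sub>L real" where f: "0 \<le> f" "blinfun_apply f x = norm (pprt x)" "norm f \<le> 1"
  proof (rule exists_positive_functional[of "norm :: 'a \<Rightarrow> real" 1])
  qed (auto simp: norm_mono_nonneg norm_triangle_ineq)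
  have "norm x = blinfun_apply f x"
    using f(2) \<open>0 \<le> x\<close> by simp
  also have "\<dots> \<le> blinfun_apply \<Phi> f"
    using assms(2) f(1) by (simp add: bidual_embedding_le_iff)
  also have "\<dots> \<le> norm \<Phi> * norm f"
    using norm_blinfun[of \<Phi> f] by simp
  also have "\<dots> \<le> norm \<Phi>"
    using mult_left_mono[OF f(3) norm_ge_zero[of \<Phi>]] by simp
  finally show ?thesis .
qed

section \<open>Lattice seminorms\<close>

lemma nonneg_limit:
  fixes x :: "nat \<Rightarrow> 'a::banach_lattice"
  assumes "x \<longlonglongrightarrow> l" "eventually (\<lambda>n. 0 \<le> x n) sequentially"
  shows "0 \<le> l"
proof -
  have "norm (pprt (- l)) \<le> norm (x n - l)" if "0 \<le> x n" for n
  proof (rule norm_lattice_mono)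
    have "- l \<le> \<bar>x n - l\<bar>"
      using that by (intro order_trans[OF _ abs_ge_self]) simp
    then show "\<bar>pprt (- l)\<bar> \<le> \<bar>x n - l\<bar>"
      by (simp add: pprt_le_iff)
  qed
  then have "eventually (\<lambda>n. norm (pprt (- l)) \<le> norm (x n - l)) sequentially"
    using assms(2) by (auto elim: eventually_mono)
  moreover have "(\<lambda>n. norm (x n - l)) \<longlonglongrightarrow> 0"
    using assms(1) by (simp add: tendsto_norm_zero LIM_zero)
  ultimately have "norm (pprt (- l)) \<le> 0"
    by (intro tendsto_lowerbound[of _ 0 sequentially]) auto
  then have "pprt (- l) = 0" by simp
  then show ?thesis
    by (simp flip: le_zero_iff_zero_pprt)
qed

lemma le_suminf:
  fixes x :: "nat \<Rightarrow> 'a::banach_lattice"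
  assumes "summable x" "\<And>n. 0 \<le> x n"
  shows "x n \<le> suminf x"
proof -
  have "0 \<le> suminf x - x n"
  proof (rule nonneg_limit)
    show "(\<lambda>N. sum x {..<N} - x n) \<longlonglongrightarrow> suminf x - x n"
      using assms(1) by (intro tendsto_intros summable_LIMSEQ)
    show "eventually (\<lambda>N. 0 \<le> sum x {..<N} - x n) sequentially"
      using eventually_gt_at_top[of n]
    proof eventually_elim
      case (elim N)
      then show ?case
        using sum_mono2[of "{..<N}" "{n}" x] assms(2) by simp
    qed
  qed
  then show ?thesis by simp
qed

lemma sum_half_powers_le: "(\<Sum>i\<in>I. (1/2) ^ i) \<le> (2::real)" if "finite I"
proof -
  have "(\<Sum>i\<in>I. (1/2) ^ i) \<le> (\<Sum>i. (1/2::real) ^ i)"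
    using that by (intro sum_le_suminf summable_geometric) auto
  then show ?thesis
    by (simp add: suminf_geometric)
qed

lemma disjoint_seqI:
  assumes "\<And>n. 0 \<le> x n" "\<And>n m. n < m \<Longrightarrow> inf (x n) (x m) = 0"
  shows "disjoint_seq x"
  unfolding disjoint_seq_def
proof (intro allI impI)
  fix n m :: nat assume "n \<noteq> m"
  then show "inf \<bar>x n\<bar> \<bar>x m\<bar> = 0"
    using assms(2)[of n m] assms(2)[of m n] assms(1)
    by (cases "n < m") (auto simp: inf_commute)
qed

lemma disjoint_seq_mono:
  assumes "disjoint_seq x" "\<And>n. 0 \<le> y n" "\<And>n. y n \<le> \<bar>x n\<bar>"
  shows "disjoint_seq y"
proof (rule disjoint_seqI)
  show "inf (y n) (y m) = 0" if "n < m" for n m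
  proof -
    have "inf \<bar>x n\<bar> \<bar>x m\<bar> = 0"
      using assms(1) that by (simp add: disjoint_seq_def)
    then show ?thesis
      by (rule disjoint_mono) (rule assms(2,3))+
  qed
qed (rule assms)

text \<open>Monotonicity in the modulus separates \<open>q_seminorm T\<close> from
  \<open>norm (T x)\<close>. The bound by the norm makes the functionals obtained from Hahn-Banach
  continuous; for \<open>q_seminorm T\<close> the constant is \<open>norm T\<close>.\<close>

locale lattice_seminorm =
  fixes q :: "'a::banach_lattice \<Rightarrow> real" and K :: real
  assumes q_mono: "\<bar>x\<bar> \<le> \<bar>y\<bar> \<Longrightarrow> q x \<le> q y"
    and q_add: "q (x + y) \<le> q x + q y"
    and q_scaleR: "q (c *\<^sub>R x) = \<bar>c\<bar> * q x"
    and q_le_norm: "q x \<le> K * norm x"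
    and K_nonneg: "0 \<le> K"
begin

lemma q_zero [simp]: "q 0 = 0"
  using q_scaleR[of 0 0] by simp

lemma q_nonneg [simp]: "0 \<le> q x"
  using q_mono[of 0 x] by simp

lemma q_abs [simp]: "q \<bar>x\<bar> = q x"
  by (intro antisym q_mono) simp_all

lemma q_mono_nonneg: "0 \<le> x \<Longrightarrow> x \<le> y \<Longrightarrow> q x \<le> q y"
  using order_trans[of 0 x y] by (intro q_mono) simp

lemma q_abs_le: "\<bar>x\<bar> \<le> y \<Longrightarrow> q x \<le> q y"
  using q_mono_nonneg[of "\<bar>x\<bar>" y] by simp

lemma q_minus_commute: "q (x - y) = q (y - x)"
  by (metis abs_minus_commute q_abs)

lemma q_sum: "q (sum f I) \<le> (\<Sum>i\<in>I. q (f i))"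
proof (induction I rule: infinite_finite_induct)
  case (insert i I)
  then show ?case using q_add[of "f i" "sum f I"] by simp
qed auto

lemma exists_norming_positive_functional:
  assumes "0 \<le> z"
  obtains f :: "'a \<Rightarrow>\<^sub>L real"
  where "0 \<le> f" "\<And>x. 0 \<le> x \<Longrightarrow> blinfun_apply f x \<le> q x" "blinfun_apply f z = q z"
proof -
  obtain f :: "'a \<Rightarrow>\<^sub>L real"
    where "0 \<le> f" "\<And>x. 0 \<le> x \<Longrightarrow> blinfun_apply f x \<le> q x" "blinfun_apply f z = q (pprt z)"
  proof (rule exists_positive_functional[of q K z])
  qed (auto intro: q_mono_nonneg q_add q_le_norm K_nonneg simp: q_scaleR)
  with assms show thesis
    by (intro that) auto
qed

text \<open>Assertion (4) for \<open>q\<close>, localized to a set, so that it serves both for order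
  intervals of the lattice and for traces of those of the bidual.\<close>

definition disjoint_null :: "'a set \<Rightarrow> bool"
  where "disjoint_null D \<longleftrightarrow>
    (\<forall>x. range x \<subseteq> D \<longrightarrow> disjoint_seq x \<longrightarrow> (\<lambda>n. q (x n)) \<longlonglongrightarrow> 0)"

text \<open>
  If no \<open>u\<close> works, choose \<open>x (n + 1)\<close> in \<open>D\<close> badly approximated by \<open>u = 4\<^sup>n (x 0 + \<dots> + x n)\<close>.
  Subtracting this \<open>u\<close> and a small multiple of a weighted sum of all the \<open>x i\<close> makes the sequence
  disjoint without making it small.
\<close>

lemma approximately_order_bounded:
  assumes nonneg: "\<And>x. x \<in> D \<Longrightarrow> 0 \<le> x"
    and solid: "\<And>x y. x \<in> D \<Longrightarrow> 0 \<le> y \<Longrightarrow> y \<le> x \<Longrightarrow> y \<in> D"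
    and bounded: "\<And>x. x \<in> D \<Longrightarrow> norm x \<le> B"
    and null: "disjoint_null D" and "0 < e"
  obtains u where "0 \<le> u" "\<And>x. x \<in> D \<Longrightarrow> q (pprt (x - u)) \<le> e"
proof (rule ccontr)
  assume "\<not> thesis"
  with that have bad: "\<exists>x\<in>D. e < q (pprt (x - u))" if "0 \<le> u" for u
    using \<open>0 \<le> u\<close> by (meson not_le)
  \<comment> \<open>\<open>z n\<close> carries \<open>x n\<close> together with the partial sum
    \<open>x 0 + ... + x n\<close>, which is all that the next choice needs to know of the
    past.\<close>
  have "\<exists>z. \<forall>n. (fst (z n) \<in> D \<and> fst (z n) \<le> snd (z n)) \<and>
      (e < q (pprt (fst (z (Suc n)) - 4 ^ n *\<^sub>R snd (z n))) \<and>
        snd (z (Suc n)) = snd (z n) + fst (z (Suc n)))"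
  proof (rule dependent_nat_choice)
    obtain x where "x \<in> D" using bad[of 0] by auto
    then show "\<exists>z. fst z \<in> D \<and> fst z \<le> snd z"
      by (intro exI[of _ "(x, x)"]) simp
  next
    fix z :: "'a \<times> 'a" and n :: nat
    assume z: "fst z \<in> D \<and> fst z \<le> snd z"
    then have s: "0 \<le> snd z"
      using nonneg order_trans by blast
    then obtain x where "x \<in> D" "e < q (pprt (x - 4 ^ n *\<^sub>R snd z))"
      using bad[of "4 ^ n *\<^sub>R snd z"] by (auto simp: scaleR_nonneg_nonneg)
    then show "\<exists>z'. (fst z' \<in> D \<and> fst z' \<le> snd z') \<and>
        (e < q (pprt (fst z' - 4 ^ n *\<^sub>R snd z)) \<and> snd z' = snd z + fst z')"
      using s by (intro exI[of _ "(x, snd z + x)"]) simp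
  qed
  then obtain z where z: "\<And>n. fst (z n) \<in> D" "\<And>n. fst (z n) \<le> snd (z n)"
    "\<And>n. e < q (pprt (fst (z (Suc n)) - 4 ^ n *\<^sub>R snd (z n)))"
    "\<And>n. snd (z (Suc n)) = snd (z n) + fst (z (Suc n))"
    by blast
  define x where "x n = fst (z n)" for n
  define s where "s n = snd (z n)" for n
  have x: "x n \<in> D" "0 \<le> x n" "norm (x n) \<le> B" for n
    using z(1) nonneg bounded by (auto simp: x_def)
  have s_Suc: "s (Suc n) = s n + x (Suc n)" for n
    using z(4) by (simp add: s_def x_def)
  have "s n \<le> s (Suc n)" for n
    using x(2) by (simp add: s_Suc)
  then have "incseq s" by (rule incseq_SucI)
  then have x_le_s: "x i \<le> s n" if "i \<le> n" for i n
    using z(2)[of i] that unfolding x_def s_def by (metis incseq_def order_trans)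
  have s: "0 \<le> s n" for n
    using x(2)[of n] x_le_s[of n n] by simp
  \<comment> \<open>The uniform norm bound makes the weighted series converge; its sum dominates
    every term and provides the single element \<open>X\<close>.\<close>
  have "summable (\<lambda>i. (1/2) ^ i *\<^sub>R x i)"
  proof (rule summable_comparison_test')
    show "summable (\<lambda>i. (1/2) ^ i * B)"
      by (intro summable_mult2 summable_geometric) simp
    show "norm ((1/2) ^ i *\<^sub>R x i) \<le> (1/2) ^ i * B" for i
      using x(3)[of i] by (simp add: mult_left_mono)
  qed
  moreover have "0 \<le> (1/2::real) ^ i *\<^sub>R x i" for i
    using x(2) by (intro scaleR_nonneg_nonneg) auto
  ultimately have "(1/2) ^ i *\<^sub>R x i \<le> (\<Sum>i. (1/2) ^ i *\<^sub>R x i)" for i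
    by (rule le_suminf)
  then obtain X where X: "(1/2) ^ i *\<^sub>R x i \<le> X" for i
    by blast
  have X0: "0 \<le> X"
    using X[of 0] x(2)[of 0] by simp
  define v where "v n = pprt (x (Suc n) - 4 ^ n *\<^sub>R s n - (1/2) ^ n *\<^sub>R X)" for n
  have v: "0 \<le> v n" "v n \<le> x (Suc n)" for n
  proof -
    have "0 \<le> 4 ^ n *\<^sub>R s n + (1/2) ^ n *\<^sub>R X"
      using s X0 by (intro add_nonneg_nonneg scaleR_nonneg_nonneg) auto
    then have "x (Suc n) - (4 ^ n *\<^sub>R s n + (1/2) ^ n *\<^sub>R X) \<le> x (Suc n)"
      by (simp only: diff_le_eq le_add_same_cancel1)
    then show "0 \<le> v n" "v n \<le> x (Suc n)"
      using x(2)[of "Suc n"] by (simp_all only: v_def pprt_le_iff diff_diff_add zero_le_pprt simp_thms)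
  qed
  have "disjoint_seq v"
  proof (rule disjoint_seqI)
    fix n m :: nat assume nm: "n < m"
    show "inf (v n) (v m) = 0"
    proof (rule disjoint_mono)
      show "inf (pprt (x (Suc n) - (1 / 4 ^ m) *\<^sub>R x (Suc m)))
          (pprt (x (Suc m) - 4 ^ m *\<^sub>R x (Suc n))) = 0"
        using disjoint_pprt_diff_scaleR[of "4 ^ m" "x (Suc m)" "x (Suc n)"]
        by (simp add: inf_commute)
      have "4 ^ m *\<^sub>R x (Suc n) \<le> 4 ^ m *\<^sub>R s m"
        using nm x_le_s[of "Suc n" m] by (intro scaleR_left_mono) auto
      moreover have "0 \<le> (1/2::real) ^ m *\<^sub>R X"
        using X0 by (intro scaleR_nonneg_nonneg) auto
      ultimately show "v m \<le> pprt (x (Suc m) - 4 ^ m *\<^sub>R x (Suc n))"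
        unfolding v_def diff_diff_add by (intro pprt_mono diff_left_mono) (simp add: add_increasing2)
      \<comment> \<open>From \<open>n < m\<close> follows \<open>n + Suc m \<le> 2 * m\<close>, so
        the weight \<open>1 / 4 ^ m\<close> that disjointness requires is at most
        \<open>(1/2) ^ n\<close> times the weight of \<open>x (Suc m)\<close> in
        \<open>X\<close>.\<close>
      have "(1 / 4 ^ m) *\<^sub>R x (Suc m) \<le> ((1/2) ^ n * (1/2) ^ Suc m) *\<^sub>R x (Suc m)"
      proof (intro scaleR_right_mono x(2))
        have "(1 / 4 ^ m :: real) = (1/2) ^ (2 * m)"
          by (simp add: power_mult power_divide)
        also have "\<dots> \<le> (1/2) ^ (n + Suc m)"
          using nm by (intro power_decreasing) auto
        finally show "(1 / 4 ^ m :: real) \<le> (1/2) ^ n * (1/2) ^ Suc m"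
          by (simp only: power_add)
      qed
      also have "\<dots> \<le> (1/2) ^ n *\<^sub>R X"
        using scaleR_left_mono[OF X[of "Suc m"], of "(1/2) ^ n"] by simp
      finally have "(1 / 4 ^ m) *\<^sub>R x (Suc m) \<le> (1/2) ^ n *\<^sub>R X" .
      moreover have "0 \<le> (4::real) ^ n *\<^sub>R s n"
        using s by (intro scaleR_nonneg_nonneg) auto
      ultimately show "v n \<le> pprt (x (Suc n) - (1 / 4 ^ m) *\<^sub>R x (Suc m))"
        unfolding v_def diff_diff_add by (intro pprt_mono diff_left_mono) (simp add: add_increasing)
    qed (rule v(1))+
  qed (rule v(1))
  moreover have "range v \<subseteq> D"
    using v x(1) solid by blast
  ultimately have "(\<lambda>n. q (v n)) \<longlonglongrightarrow> 0"
    using null by (auto simp: disjoint_null_def)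
  moreover have "(\<lambda>n. (1/2) ^ n * q X) \<longlonglongrightarrow> 0 * q X"
    by (intro tendsto_intros LIMSEQ_power_zero) auto
  ultimately have "(\<lambda>n. q (v n) + (1/2) ^ n * q X) \<longlonglongrightarrow> 0 + 0 * q X"
    by (rule tendsto_add)
  then have lim: "(\<lambda>n. q (v n) + (1/2) ^ n * q X) \<longlonglongrightarrow> 0" by simp
  have "e \<le> q (v n) + (1/2) ^ n * q X" for n
  proof -
    have Xn: "0 \<le> (1/2) ^ n *\<^sub>R X"
      using X0 by (intro scaleR_nonneg_nonneg) auto
    have "pprt (x (Suc n) - 4 ^ n *\<^sub>R s n) \<le> v n + (1/2) ^ n *\<^sub>R X"
      using pprt_add_le[of "x (Suc n) - 4 ^ n *\<^sub>R s n - (1/2) ^ n *\<^sub>R X" "(1/2) ^ n *\<^sub>R X"] Xn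
      by (simp add: v_def)
    then have "q (pprt (x (Suc n) - 4 ^ n *\<^sub>R s n)) \<le> q (v n + (1/2) ^ n *\<^sub>R X)"
      by (intro q_mono_nonneg) auto
    also have "\<dots> \<le> q (v n) + (1/2) ^ n * q X"
      using q_add[of "v n" "(1/2) ^ n *\<^sub>R X"] by (simp add: q_scaleR)
    finally show ?thesis
      using z(3)[of n] by (simp add: x_def s_def)
  qed
  with lim have "e \<le> 0"
    by (intro tendsto_lowerbound[OF lim]) auto
  with \<open>0 < e\<close> show False by simp
qed

text \<open>Pointwise, an increasing sequence crosses each level \<open>t j *\<^sub>R u\<close> at
  most once, so for fixed \<open>j\<close> the elements \<open>v j n\<close> recording the crossing
  in step \<open>n\<close> are disjoint. Finitely many levels control the increment up to the
  mesh.\<close>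

lemma incseq_q_diff_tendsto_zero:
  assumes null: "disjoint_null {0..u}" and a: "incseq a" "\<And>n. a n \<in> {0..u}"
  shows "(\<lambda>n. q (a (Suc n) - a n)) \<longlonglongrightarrow> 0"
proof (rule LIMSEQ_I)
  fix e :: real assume e: "0 < e"
  have a': "0 \<le> a n" "a n \<le> u" for n
    using a(2)[of n] by auto
  have u: "0 \<le> u"
    using a'[of 0] by (rule order_trans)
  obtain k :: nat where "4 * q u / e < real k"
    using reals_Archimedean2 by blast
  moreover have "0 \<le> 4 * q u / e"
    using e by simp
  ultimately have "0 < real k" "4 * q u / e < real k"
    by linarith+
  with e have k: "0 < real k" "4 * q u < e * real k"
    by (simp_all add: divide_less_eq mult.commute)
  define t where "t j = -1 + 2 * real j / real k" for j
  define v where "v j n = inf (pprt (a (Suc n) - t j *\<^sub>R u)) (pprt (t j *\<^sub>R u - a n))" for j n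
  have v0: "0 \<le> v j n" for j n
    by (simp add: v_def)
  have "(\<lambda>n. q (v j n)) \<longlonglongrightarrow> 0" for j
  proof -
    have "disjoint_seq (v j)"
    proof (rule disjoint_seqI)
      fix n m :: nat assume nm: "n < m"
      show "inf (v j n) (v j m) = 0"
      proof (rule disjoint_mono)
        show "inf (pprt (a (Suc n) - t j *\<^sub>R u)) (pprt (- (a (Suc n) - t j *\<^sub>R u))) = 0"
          by (rule inf_pprt_pprt_minus)
        have "a (Suc n) \<le> a m"
          using a(1) nm by (simp add: incseq_def)
        then have "pprt (t j *\<^sub>R u - a m) \<le> pprt (- (a (Suc n) - t j *\<^sub>R u))"
          by (intro pprt_mono) (simp add: diff_left_mono)
        then show "v j m \<le> pprt (- (a (Suc n) - t j *\<^sub>R u))"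
          unfolding v_def by (rule le_infI2)
      qed (simp_all add: v0 v_def)
    qed (rule v0)
    \<comment> \<open>The grid runs from \<open>- u\<close> to \<open>u\<close>, so levels may be
      negative: for \<open>0 \<le> t j\<close> the first factor of \<open>v j n\<close> is at most
      \<open>u\<close>, otherwise the second.\<close>
    moreover have "v j n \<le> u" for n
    proof (cases "0 \<le> t j")
      case True
      then have "0 \<le> t j *\<^sub>R u"
        using u by (rule scaleR_nonneg_nonneg)
      then have "a (Suc n) - t j *\<^sub>R u \<le> a (Suc n)" by simp
      then have "pprt (a (Suc n) - t j *\<^sub>R u) \<le> u"
        using a'(2)[of "Suc n"] u by (simp only: pprt_le_iff) (metis order_trans)
      then show ?thesis
        unfolding v_def by (rule le_infI1)
    next
      case False
      then have "t j *\<^sub>R u \<le> 0"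
        using u by (simp add: scaleR_nonpos_nonneg)
      then have "t j *\<^sub>R u - a n \<le> u"
        using a'(1)[of n] u by (meson diff_le_0_iff_le order_trans)
      then have "pprt (t j *\<^sub>R u - a n) \<le> u"
        using u by (simp only: pprt_le_iff)
      then show ?thesis
        unfolding v_def by (rule le_infI2)
    qed
    moreover from this have "range (v j) \<subseteq> {0..u}"
      using v0 by auto
    ultimately show ?thesis
      using null by (simp add: disjoint_null_def)
  qed
  then have "(\<lambda>n. \<Sum>j\<le>k. q (v j n)) \<longlonglongrightarrow> (\<Sum>j\<le>k. 0)"
    by (intro tendsto_sum)
  then have "(\<lambda>n. \<Sum>j\<le>k. q (v j n)) \<longlonglongrightarrow> 0" by simp
  then have ev: "eventually (\<lambda>n. (\<Sum>j\<le>k. q (v j n)) < e / 4) sequentially"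
    using e by (intro order_tendstoD) auto
  have "q (a (Suc n) - a n) \<le> (2 / real k) * q u + 2 * (\<Sum>j\<le>k. q (v j n))" for n
  proof -
    have le: "a n \<le> a (Suc n)"
      using a(1) by (simp add: incseq_def)
    have clip: "clip u (a m) = a m" for m
    proof (rule clip_eq)
      show "- u \<le> a m"
        using u a'(1)[of m] by (meson neg_le_0_iff_le order_trans)
    qed (rule a')
    have "clip u (a (Suc n)) - clip u (a n) \<le> (2 / real k) *\<^sub>R u + 2 *\<^sub>R (\<Sum>j\<le>k. v j n)"
      unfolding v_def
    proof (rule clip_diff_le_grid)
      show "t k = 1" "t 0 = -1" "t (Suc j) - t j \<le> 2 / real k" for j
        using k(1) by (simp_all add: t_def field_simps)
    qed (use le u in auto)
    then have "q (a (Suc n) - a n) \<le> q ((2 / real k) *\<^sub>R u + 2 *\<^sub>R (\<Sum>j\<le>k. v j n))"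
      using le unfolding clip by (intro q_mono_nonneg) simp
    also have "\<dots> \<le> q ((2 / real k) *\<^sub>R u) + q (2 *\<^sub>R (\<Sum>j\<le>k. v j n))"
      by (rule q_add)
    also have "\<dots> \<le> (2 / real k) * q u + 2 * (\<Sum>j\<le>k. q (v j n))"
      using q_sum[of "\<lambda>j. v j n" "{..k}"] by (simp add: q_scaleR)
    finally show ?thesis .
  qed
  moreover have "(2 / real k) * q u < e / 2"
    using k by (simp add: field_simps)
  ultimately have less: "q (a (Suc n) - a n) < e" if "(\<Sum>j\<le>k. q (v j n)) < e / 4" for n
  proof -
    have "q (a (Suc n) - a n) \<le> (2 / real k) * q u + 2 * (\<Sum>j\<le>k. q (v j n))"
      by fact
    then show ?thesis
      using that \<open>(2 / real k) * q u < e / 2\<close> by linarith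
  qed
  from ev have "eventually (\<lambda>n. norm (q (a (Suc n) - a n) - 0) < e) sequentially"
    by eventually_elim (simp add: less)
  then show "\<exists>no. \<forall>n\<ge>no. norm (q (a (Suc n) - a n) - 0) < e"
    by (simp add: eventually_sequentially)
qed

lemma incseq_q_Cauchy:
  assumes null: "disjoint_null {0..u}" and a: "incseq a" "\<And>n. a n \<in> {0..u}" and "0 < e"
  shows "\<exists>N. \<forall>m\<ge>N. q (a m - a N) \<le> e"
proof (rule ccontr)
  assume "\<not> ?thesis"
  then have bad: "\<exists>m\<ge>N. e < q (a m - a N)" for N
    by (meson not_le)
  have "\<exists>r. \<forall>n. True \<and> (r n \<le> r (Suc n) \<and> e < q (a (r (Suc n)) - a (r n)))"
    by (rule dependent_nat_choice) (use bad in auto)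
  then obtain r where r: "\<And>n. r n \<le> r (Suc n)" "\<And>n. e < q (a (r (Suc n)) - a (r n))"
    by blast
  have "incseq r" using r(1) by (rule incseq_SucI)
  then have "incseq (\<lambda>n. a (r n))"
    using a(1) by (simp add: incseq_def)
  then have "(\<lambda>n. q (a (r (Suc n)) - a (r n))) \<longlonglongrightarrow> 0"
    by (rule incseq_q_diff_tendsto_zero[OF null]) (rule a)
  then have "e \<le> 0"
    by (rule tendsto_lowerbound) (use r(2) in \<open>auto simp: less_imp_le\<close>)
  with \<open>0 < e\<close> show False by simp
qed

lemma decseq_q_diff_tendsto_zero:
  assumes null: "disjoint_null {0..u}" and a: "decseq a" "\<And>n. a n \<in> {0..u}"
  shows "(\<lambda>n. q (a n - a (Suc n))) \<longlonglongrightarrow> 0"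
proof -
  have "(\<lambda>n. q ((u - a (Suc n)) - (u - a n))) \<longlonglongrightarrow> 0"
    using a by (intro incseq_q_diff_tendsto_zero[OF null])
      (auto simp: incseq_def decseq_def intro: diff_left_mono)
  then show ?thesis by simp
qed

text \<open>
  If no functional works, choose \<open>w n\<close> with \<open>q (w n) > e\<close> on which norming functionals of the earlier
  \<open>w i\<close> are tiny. The suprema of the tails of \<open>w\<close> are \<open>q\<close>-almost a decreasing sequence, which is
  \<open>q\<close>-Cauchy; hence the functional norming \<open>w n\<close> is not small on the tails far beyond \<open>n\<close>.
\<close>

lemma absolutely_continuous:
  assumes null: "disjoint_null {0..u}" and "0 < e"
  obtains \<mu> :: "'a \<Rightarrow>\<^sub>L real" and d
  where "0 \<le> \<mu>" "0 < d" "\<And>w. w \<in> {0..u} \<Longrightarrow> blinfun_apply \<mu> w \<le> d \<Longrightarrow> q w \<le> e"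
proof (rule ccontr)
  assume "\<not> thesis"
  with that have bad: "\<exists>w\<in>{0..u}. blinfun_apply \<mu> w \<le> d \<and> e < q w"
    if "0 \<le> \<mu>" "0 < d" for \<mu> :: "'a \<Rightarrow>\<^sub>L real" and d
    using \<open>0 \<le> \<mu>\<close> \<open>0 < d\<close> by (meson not_le)
  \<comment> \<open>The final estimate spends \<open>2 * h + h + 2 * h\<close>, which is below
    \<open>6 * h\<close>.\<close>
  define h where "h = e / 6"
  have h: "0 < h" using \<open>0 < e\<close> by (simp add: h_def)
  have "\<exists>F. \<forall>w\<ge>0. 0 \<le> F w \<and> (\<forall>x\<ge>0. blinfun_apply (F w) x \<le> q x) \<and> blinfun_apply (F w) w = q w"
    by (rule exI[of _ "\<lambda>w. SOME f. 0 \<le> f \<and> (\<forall>x\<ge>0. blinfun_apply f x \<le> q x) \<and> blinfun_apply f w = q w"],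
        intro allI impI, rule someI_ex, erule exists_norming_positive_functional) blast
  then obtain F :: "'a \<Rightarrow> 'a \<Rightarrow>\<^sub>L real" where F: "\<And>w. 0 \<le> w \<Longrightarrow> 0 \<le> F w"
    "\<And>w x. 0 \<le> w \<Longrightarrow> 0 \<le> x \<Longrightarrow> blinfun_apply (F w) x \<le> q x"
    "\<And>w. 0 \<le> w \<Longrightarrow> blinfun_apply (F w) w = q w"
    by blast
  \<comment> \<open>The second component adds up the functionals norming
    \<open>w 0, ..., w n\<close>. They are positive, so if the sum is small on the next element,
    each of them is.\<close>
  have "\<exists>z. \<forall>n. (fst (z n) \<in> {0..u} \<and> e < q (fst (z n)) \<and> 0 \<le> snd (z n) \<and> F (fst (z n)) \<le> snd (z n)) \<and>
    (blinfun_apply (snd (z n)) (fst (z (Suc n))) \<le> h * (1/2) ^ n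
      \<and> snd (z (Suc n)) = snd (z n) + F (fst (z (Suc n))))"
  proof (rule dependent_nat_choice)
    obtain w where w: "w \<in> {0..u}" "e < q w" using bad[of 0 1] by auto
    then show "\<exists>z. fst z \<in> {0..u} \<and> e < q (fst z) \<and> 0 \<le> snd z \<and> F (fst z) \<le> snd z"
      using F(1)[of w] by (intro exI[of _ "(w, F w)"]) simp
  next
    fix z :: "'a \<times> ('a \<Rightarrow>\<^sub>L real)" and n :: nat
    assume z: "fst z \<in> {0..u} \<and> e < q (fst z) \<and> 0 \<le> snd z \<and> F (fst z) \<le> snd z"
    then obtain w where w: "w \<in> {0..u}" "blinfun_apply (snd z) w \<le> h * (1/2) ^ n" "e < q w"
      using bad[of "snd z" "h * (1/2) ^ n"] h by auto
    then show "\<exists>z'. (fst z' \<in> {0..u} \<and> e < q (fst z') \<and> 0 \<le> snd z' \<and> F (fst z') \<le> snd z') \<and>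
      (blinfun_apply (snd z) (fst z') \<le> h * (1/2) ^ n \<and> snd z' = snd z + F (fst z'))"
      using z F(1)[of w]
      by (intro exI[of _ "(w, snd z + F w)"]) (simp add: less_eq_blinfun_def blinfun.add_left)
  qed
  then obtain z where z: "\<And>n. fst (z n) \<in> {0..u}" "\<And>n. e < q (fst (z n))"
    "\<And>n. F (fst (z n)) \<le> snd (z n)"
    "\<And>n. blinfun_apply (snd (z n)) (fst (z (Suc n))) \<le> h * (1/2) ^ n"
    "\<And>n. snd (z (Suc n)) = snd (z n) + F (fst (z (Suc n)))"
    by blast
  define w where "w n = fst (z n)" for n
  have w: "0 \<le> w n" "w n \<le> u" "e < q (w n)" for n
    using z(1,2)[of n] by (auto simp: w_def)
  have u: "0 \<le> u"
    using w(1,2)[of 0] by (rule order_trans)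
  have F_le: "blinfun_apply (F (w n)) x \<le> blinfun_apply (snd (z m)) x" if "n \<le> m" "0 \<le> x" for n m x
    using \<open>n \<le> m\<close>
  proof (induction m rule: dec_induct)
    case base
    show ?case using z(3)[of n] that(2) by (simp add: w_def less_eq_blinfun_def)
  next
    case (step m)
    have "0 \<le> blinfun_apply (F (w (Suc m))) x"
      using F(1) w(1) that(2) by (intro blinfun_nonneg) auto
    with step.IH show ?case by (simp add: z(5) blinfun.add_left w_def)
  qed
  have F_small: "blinfun_apply (F (w n)) (w (Suc m)) \<le> h * (1/2) ^ m" if "n \<le> m" for n m
    using F_le[OF that w(1)[of "Suc m"]] z(4)[of m] by (simp add: w_def)

  define a where "a i k = Sup_fin (w ` {i..i + k})" for i k
  have w_le_a: "w m \<le> a i k" if "i \<le> m" "m \<le> i + k" for m i k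
    unfolding a_def using that by (intro Sup_fin.coboundedI) auto
  have a_le: "a i k \<le> x" if "\<And>m. i \<le> m \<Longrightarrow> m \<le> i + k \<Longrightarrow> w m \<le> x" for i k x
    unfolding a_def using that by (intro Sup_fin.boundedI) auto
  have a_bounds: "a i k \<in> {0..u}" for i k
    using w_le_a[of i i k] w(1)[of i] a_le[of i k u] w(2) by (auto intro: order_trans)
  have a_mono: "a j l \<le> a i k" if "i \<le> j" "j + l \<le> i + k" for i j k l
    using that by (intro a_le w_le_a) auto
  have "\<exists>N. \<forall>i. \<forall>m\<ge>N i. q (a i m - a i (N i)) \<le> h * (1/2) ^ i"
  proof (rule choice, rule allI)
    fix i
    show "\<exists>N. \<forall>m\<ge>N. q (a i m - a i N) \<le> h * (1/2) ^ i"
    proof (rule incseq_q_Cauchy[OF null])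
      show "incseq (a i)"
        unfolding incseq_def by (intro allI impI a_mono) auto
    qed (use h a_bounds in auto)
  qed
  then obtain N where N: "\<And>i m. N i \<le> m \<Longrightarrow> q (a i m - a i (N i)) \<le> h * (1/2) ^ i"
    by blast
  \<comment> \<open>\<open>b n\<close> stands in for the supremum of the tail from \<open>n\<close>,
    which need not exist in the lattice, up to the error fixed by \<open>N n\<close>. These elements
    need not decrease, so \<open>d n\<close> takes the infimum of
    \<open>b 0, ..., b n\<close>.\<close>
  define b where "b n = a n (N n)" for n
  define d where "d n = Inf_fin (b ` {..n})" for n
  have d_le: "d n \<le> b i" if "i \<le> n" for i n
    unfolding d_def using that by (intro Inf_fin.coboundedI) auto
  have le_d: "x \<le> d n" if "\<And>i. i \<le> n \<Longrightarrow> x \<le> b i" for n x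
    unfolding d_def using that by (intro Inf_fin.boundedI) auto
  have b_bounds: "b n \<in> {0..u}" for n
    unfolding b_def by (rule a_bounds)
  have d_bounds: "d n \<in> {0..u}" for n
  proof -
    have "0 \<le> d n" using b_bounds by (intro le_d) auto
    moreover have "d n \<le> u" using d_le[of n n] b_bounds[of n] by (auto intro: order_trans)
    ultimately show ?thesis by simp
  qed
  have "decseq d"
    unfolding decseq_def by (intro allI impI le_d d_le) auto
  then have "(\<lambda>n. q (d n - d (Suc n))) \<longlonglongrightarrow> 0"
    by (rule decseq_q_diff_tendsto_zero[OF null]) (rule d_bounds)
  then have "eventually (\<lambda>n. q (d n - d (Suc n)) < h) sequentially"
    using h by (intro order_tendstoD) auto
  then obtain n where n: "q (d n - d (Suc n)) < h"
    by (auto simp: eventually_sequentially)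

  \<comment> \<open>\<open>b n\<close> is a supremum over part of the tail from \<open>i\<close>,
    which exceeds \<open>b i\<close> only by the error fixed by \<open>N i\<close>.\<close>
  have "q (pprt (b n - b i)) \<le> h * (1/2) ^ i" if "i \<le> n" for i
  proof -
    define m where "m = n - i + N n"
    have "b n \<le> a i m"
      unfolding b_def m_def using that by (intro a_mono) auto
    then have *: "pprt (b n - b i) \<le> pprt (a i m - a i (N i))"
      unfolding b_def[of i] by (intro pprt_mono diff_right_mono)
    show ?thesis
    proof (cases "N i \<le> m")
      case True
      then have "a i (N i) \<le> a i m" by (intro a_mono) auto
      with * have "q (pprt (b n - b i)) \<le> q (a i m - a i (N i))"
        by (intro q_mono_nonneg) auto
      then show ?thesis using N[OF True] by simp
    next
      case False
      then have "a i m \<le> a i (N i)" by (intro a_mono) auto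
      then have "pprt (a i m - a i (N i)) = 0" by simp
      with * have "pprt (b n - b i) = 0" by (intro antisym) simp_all
      then show ?thesis using h by simp
    qed
  qed
  then have "(\<Sum>i\<le>n. q (pprt (b n - b i))) \<le> (\<Sum>i\<le>n. h * (1/2) ^ i)"
    by (intro sum_mono) auto
  also have "\<dots> \<le> h * 2"
    unfolding sum_distrib_left[symmetric] using h by (intro mult_left_mono sum_half_powers_le) auto
  finally have sum_le: "(\<Sum>i\<le>n. q (pprt (b n - b i))) \<le> h * 2" .
  have "b n - (\<Sum>i\<le>n. pprt (b n - b i)) \<le> d n"
  proof (rule le_d)
    fix i assume "i \<le> n"
    then have "pprt (b n - b i) \<le> (\<Sum>i\<le>n. pprt (b n - b i))"
      using sum_mono2[of "{..n}" "{i}" "\<lambda>i. pprt (b n - b i)"] by simp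
    with le_pprt[of "b n - b i"] have "b n - b i \<le> (\<Sum>i\<le>n. pprt (b n - b i))"
      by (rule order_trans)
    then show "b n - (\<Sum>i\<le>n. pprt (b n - b i)) \<le> b i"
      by (simp only: diff_le_eq add.commute)
  qed
  then have "b n - d n \<le> (\<Sum>i\<le>n. pprt (b n - b i))"
    by (simp only: diff_le_eq add.commute)
  then have "q (b n - d n) \<le> q (\<Sum>i\<le>n. pprt (b n - b i))"
    using d_le[of n n] by (intro q_mono_nonneg) auto
  also have "\<dots> \<le> (\<Sum>i\<le>n. q (pprt (b n - b i)))"
    by (rule q_sum)
  finally have bd: "q (b n - d n) \<le> h * 2"
    using sum_le by simp

  \<comment> \<open>Bounding the supremum crudely by the sum suffices: all indices exceed
    \<open>n\<close>, where the functional norming \<open>w n\<close> decays geometrically.\<close>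
  have "d (Suc n) \<le> (\<Sum>m=Suc n..Suc n + N (Suc n). w m)"
  proof (rule order_trans[OF d_le[of "Suc n"]])
    show "b (Suc n) \<le> (\<Sum>m=Suc n..Suc n + N (Suc n). w m)"
      unfolding b_def
    proof (rule a_le)
      fix m assume "Suc n \<le> m" "m \<le> Suc n + N (Suc n)"
      then show "w m \<le> (\<Sum>m=Suc n..Suc n + N (Suc n). w m)"
        using sum_mono2[of "{Suc n..Suc n + N (Suc n)}" "{m}" w] w(1) by simp
    qed
  qed simp
  then have "blinfun_apply (F (w n)) (d (Suc n)) \<le> blinfun_apply (F (w n)) (\<Sum>m=Suc n..Suc n + N (Suc n). w m)"
    using F(1) w(1) by (intro blinfun_mono) auto
  also have "\<dots> = (\<Sum>m=Suc n..Suc (n + N (Suc n)). blinfun_apply (F (w n)) (w m))"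
    by (simp only: blinfun.sum_right add_Suc)
  also have "\<dots> = (\<Sum>m=n..n + N (Suc n). blinfun_apply (F (w n)) (w (Suc m)))"
    by (rule sum.shift_bounds_cl_Suc_ivl)
  also have "\<dots> \<le> (\<Sum>m=n..n + N (Suc n). h * (1/2) ^ m)"
    by (intro sum_mono F_small) auto
  also have "\<dots> \<le> h * 2"
    unfolding sum_distrib_left[symmetric] using h by (intro mult_left_mono sum_half_powers_le) auto
  finally have Fd: "blinfun_apply (F (w n)) (d (Suc n)) \<le> h * 2" .

  have "w n \<le> b n"
    unfolding b_def by (rule w_le_a) auto
  then have "q (w n) \<le> blinfun_apply (F (w n)) (b n)"
    using F(1,3)[OF w(1)[of n]] blinfun_mono[of "F (w n)" "w n" "b n"] by simp
  also have "\<dots> = blinfun_apply (F (w n)) (b n - d n) + blinfun_apply (F (w n)) (d n - d (Suc n))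
      + blinfun_apply (F (w n)) (d (Suc n))"
    by (simp add: blinfun.diff_right)
  also have "\<dots> \<le> q (b n - d n) + q (d n - d (Suc n)) + h * 2"
    using Fd d_le[of n n] \<open>decseq d\<close>
    by (intro add_mono F(2) w(1)) (simp_all add: decseq_def)
  also have "\<dots> < e"
    using bd n h unfolding h_def by linarith
  finally show False
    using w(3)[of n] by simp
qed

text \<open>
  On convex sets whose elements are uniformly close to an order interval \<open>{- u..u}\<close>, the convex
  functional \<open>x \<mapsto> \<Sum>\<^sub>j \<mu> ((x - t\<^sub>j u)\<^sup>+)\<close> replaces the square of a Hilbert norm: its convexity
  defect at \<open>x\<close> and \<open>y\<close> controls the \<open>\<mu>\<close>-distance of \<open>x\<close> and \<open>y\<close>.
\<close>

lemma directed_convex_approximation: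
  assumes null: "\<And>u. 0 \<le> u \<Longrightarrow> disjoint_null {0..u}"
    and nonempty: "\<C> \<noteq> {}" "\<And>C. C \<in> \<C> \<Longrightarrow> C \<noteq> {}"
    and convex: "\<And>C. C \<in> \<C> \<Longrightarrow> convex C"
    and subset: "\<And>C. C \<in> \<C> \<Longrightarrow> C \<subseteq> B"
    and directed: "\<And>C D. C \<in> \<C> \<Longrightarrow> D \<in> \<C> \<Longrightarrow> \<exists>E\<in>\<C>. E \<subseteq> C \<inter> D"
    and bounded: "\<And>x. x \<in> B \<Longrightarrow> norm x \<le> M"
    and tight: "\<And>e. 0 < e \<Longrightarrow> \<exists>u\<ge>0. \<forall>x\<in>B. q (pprt (\<bar>x\<bar> - u)) \<le> e"
    and "0 < e"
  obtains x where "x \<in> B" "\<And>D. D \<in> \<C> \<Longrightarrow> \<exists>y\<in>D. q (x - y) \<le> e"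
proof -
  have "0 < e / 3" using \<open>0 < e\<close> by simp
  then obtain u where u: "0 \<le> u" "\<And>x. x \<in> B \<Longrightarrow> q (pprt (\<bar>x\<bar> - u)) \<le> e / 3"
    using tight by blast
  \<comment> \<open>Absolute continuity is needed on twice the interval, since two truncations to
    \<open>{- u..u}\<close> may differ by \<open>u + u\<close>.\<close>
  then have "0 \<le> u + u" by simp
  from absolutely_continuous[OF null[OF this] \<open>0 < e / 3\<close>]
  obtain \<mu> :: "'a \<Rightarrow>\<^sub>L real" and d where \<mu>: "0 \<le> \<mu>" and d: "0 < d"
    and ac: "\<And>w. w \<in> {0..u + u} \<Longrightarrow> blinfun_apply \<mu> w \<le> d \<Longrightarrow> q w \<le> e / 3"
    by blast
  have \<mu>u: "0 \<le> blinfun_apply \<mu> u"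
    using \<mu> u(1) by (rule blinfun_nonneg)
  obtain k :: nat where "4 * blinfun_apply \<mu> u / d < real k"
    using reals_Archimedean2 by blast
  moreover have "0 \<le> 4 * blinfun_apply \<mu> u / d"
    using d \<mu>u by simp
  ultimately have "0 < real k" "4 * blinfun_apply \<mu> u / d < real k"
    by linarith+
  with d have k: "0 < real k" "4 * blinfun_apply \<mu> u < d * real k"
    by (simp_all add: divide_less_eq mult.commute)
  define t where "t j = -1 + 2 * real j / real k" for j
  define S where "S x = (\<Sum>j\<le>k. blinfun_apply \<mu> (pprt (x - t j *\<^sub>R u)))" for x
  have S0: "0 \<le> S x" for x
    unfolding S_def using \<mu> by (intro sum_nonneg blinfun_nonneg) auto
  define L where "L = (\<Sum>j\<le>k. norm \<mu> * (M + norm (t j *\<^sub>R u)))"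
  have SL: "S x \<le> L" if "x \<in> B" for x
    unfolding S_def L_def
  proof (rule sum_mono)
    fix j
    have "blinfun_apply \<mu> (pprt (x - t j *\<^sub>R u)) \<le> norm \<mu> * norm (pprt (x - t j *\<^sub>R u))"
      using norm_blinfun[of \<mu>] by (metis abs_le_D1 real_norm_def)
    also have "norm (pprt (x - t j *\<^sub>R u)) \<le> norm (x - t j *\<^sub>R u)"
      by (rule norm_pprt_le)
    also have "\<dots> \<le> M + norm (t j *\<^sub>R u)"
      using norm_triangle_ineq4[of x "t j *\<^sub>R u"] bounded[OF that] by simp
    finally show "blinfun_apply \<mu> (pprt (x - t j *\<^sub>R u)) \<le> norm \<mu> * (M + norm (t j *\<^sub>R u))"
      by (simp add: mult_left_mono)
  qed
  have defect: "blinfun_apply \<mu> (clip u (sup x y) - clip u (inf x y))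
      \<le> d / 2 + 2 * (S x + S y - 2 * S ((1/2) *\<^sub>R x + (1/2) *\<^sub>R y))" for x y
  proof -
    define v where "v j = inf (pprt (sup x y - t j *\<^sub>R u)) (pprt (t j *\<^sub>R u - inf x y))" for j
    have "clip u (sup x y) - clip u (inf x y) \<le> (2 / real k) *\<^sub>R u + 2 *\<^sub>R (\<Sum>j\<le>k. v j)"
      unfolding v_def
    proof (rule clip_diff_le_grid)
      show "t k = 1" "t 0 = -1" "t (Suc j) - t j \<le> 2 / real k" for j
        using k(1) by (simp_all add: t_def field_simps)
      show "inf x y \<le> sup x y"
        by (rule le_infI1) (rule sup_ge1)
    qed (use u in auto)
    with \<mu> have "blinfun_apply \<mu> (clip u (sup x y) - clip u (inf x y))
        \<le> blinfun_apply \<mu> ((2 / real k) *\<^sub>R u + 2 *\<^sub>R (\<Sum>j\<le>k. v j))"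
      by (rule blinfun_mono)
    also have "\<dots> = 2 / real k * blinfun_apply \<mu> u + 2 * (\<Sum>j\<le>k. blinfun_apply \<mu> (v j))"
      by (simp add: blinfun.add_right blinfun.scaleR_right blinfun.sum_right)
    also have "\<dots> \<le> d / 2 + 2 * (S x + S y - 2 * S ((1/2) *\<^sub>R x + (1/2) *\<^sub>R y))"
    proof (intro add_mono mult_left_mono)
      show "2 / real k * blinfun_apply \<mu> u \<le> d / 2"
        using k by (simp add: field_simps)
      have "(\<Sum>j\<le>k. blinfun_apply \<mu> (v j)) \<le> (\<Sum>j\<le>k. blinfun_apply \<mu> (pprt (x - t j *\<^sub>R u))
          + blinfun_apply \<mu> (pprt (y - t j *\<^sub>R u))
          - 2 * blinfun_apply \<mu> (pprt ((1/2) *\<^sub>R x + (1/2) *\<^sub>R y - t j *\<^sub>R u)))"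
      proof (rule sum_mono)
        fix j
        let ?s = "t j *\<^sub>R u"
        have "sup (x - ?s) (y - ?s) = sup x y - ?s" "inf (x - ?s) (y - ?s) = inf x y - ?s"
          using add_sup_distrib_right[of x y "- ?s"] add_inf_distrib_right[of x y "- ?s"] by simp_all
        then have "v j \<le> pprt (x - ?s) + pprt (y - ?s) - pprt ((x - ?s) + (y - ?s))"
          using inf_pprt_le_convexity_defect[of "x - ?s" "y - ?s"]
          by (simp only: v_def minus_diff_eq)
        also have "(x - ?s) + (y - ?s) = 2 *\<^sub>R ((1/2) *\<^sub>R x + (1/2) *\<^sub>R y - ?s)"
        proof -
          have "2 *\<^sub>R ((1/2) *\<^sub>R x + (1/2) *\<^sub>R y) = x + y"
            by (simp add: scaleR_right_distrib)
          then have "2 *\<^sub>R ((1/2) *\<^sub>R x + (1/2) *\<^sub>R y - ?s) = (x + y) - (?s + ?s)"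
            by (simp only: scaleR_right_diff_distrib scaleR_2[of ?s])
          then show ?thesis
            by (simp only: diff_conv_add_uminus minus_add_distrib ac_simps)
        qed
        also have "pprt \<dots> = 2 *\<^sub>R pprt ((1/2) *\<^sub>R x + (1/2) *\<^sub>R y - ?s)"
          by (rule scaleR_pprt[symmetric]) simp
        finally have "blinfun_apply \<mu> (v j) \<le> blinfun_apply \<mu> (pprt (x - ?s) + pprt (y - ?s)
            - 2 *\<^sub>R pprt ((1/2) *\<^sub>R x + (1/2) *\<^sub>R y - ?s))"
          using \<mu> by (intro blinfun_mono)
        then show "blinfun_apply \<mu> (v j) \<le> blinfun_apply \<mu> (pprt (x - ?s)) + blinfun_apply \<mu> (pprt (y - ?s))
            - 2 * blinfun_apply \<mu> (pprt ((1/2) *\<^sub>R x + (1/2) *\<^sub>R y - ?s))"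
          by (simp only: blinfun.add_right blinfun.diff_right blinfun.scaleR_right real_scaleR_def)
      qed
      then show "(\<Sum>j\<le>k. blinfun_apply \<mu> (v j)) \<le> S x + S y - 2 * S ((1/2) *\<^sub>R x + (1/2) *\<^sub>R y)"
        by (simp only: S_def sum.distrib sum_subtractf sum_distrib_left)
    qed auto
    finally show ?thesis .
  qed

  \<comment> \<open>Smaller members of \<open>\<C>\<close> have larger infima, so \<open>J\<close>
    is the limit of the infima along the directed family. In a \<open>C0\<close> whose infimum is
    nearly \<open>J\<close>, every point with value nearly \<open>J\<close> is a
    near-minimizer.\<close>
  define I where "I C = (INF x\<in>C. S x)" for C
  have I_le: "I C \<le> S x" if "x \<in> C" for C x
    unfolding I_def using that S0 by (intro cINF_lower bdd_belowI2[of _ 0]) auto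
  define J where "J = (SUP C\<in>\<C>. I C)"
  have bdd: "bdd_above (I ` \<C>)"
  proof (rule bdd_aboveI2)
    fix C assume C: "C \<in> \<C>"
    then obtain x where "x \<in> C" using nonempty by blast
    then show "I C \<le> L" using I_le[of x C] SL[of x] subset[OF C] by auto
  qed
  have I_le_J: "I C \<le> J" if "C \<in> \<C>" for C
    unfolding J_def using that bdd by (rule cSUP_upper)
  \<comment> \<open>With both values below \<open>J + d / 16\<close> and the midpoint above
    \<open>J - d / 16\<close>, the convexity defect is below \<open>d / 4\<close>; doubled, it fits
    into the \<open>d / 2\<close> left by the mesh.\<close>
  have near_inf: "\<exists>x\<in>C. S x < J + d / 16" if C: "C \<in> \<C>" for C
  proof -
    have "I C < J + d / 16" using I_le_J[OF C] d by simp
    then show ?thesis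
      unfolding I_def using nonempty(2)[OF C] S0
      by (subst (asm) cINF_less_iff) (auto intro: bdd_belowI2[of _ 0])
  qed
  have "J - d / 16 < J" using d by simp
  then obtain C0 where C0: "C0 \<in> \<C>" "J - d / 16 < I C0"
    unfolding J_def using bdd nonempty(1) by (subst (asm) less_cSUP_iff) auto
  obtain x where x: "x \<in> C0" "S x < J + d / 16"
    using near_inf[OF C0(1)] by blast
  show thesis
  proof (rule that[of x])
    show "x \<in> B" using x C0 subset by blast
    fix D assume D: "D \<in> \<C>"
    \<comment> \<open>\<open>x\<close> is fixed before \<open>D\<close>. Taking \<open>y\<close>
      from a member inside both \<open>C0\<close> and \<open>D\<close> keeps the midpoint in
      \<open>C0\<close>, where the lower bound for \<open>S\<close> holds.\<close>
    obtain y where y: "y \<in> C0" "y \<in> D" "S y < J + d / 16"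
      using directed[OF C0(1) D] near_inf by blast
    have xyB: "x \<in> B" "y \<in> B" using x y C0 subset by blast+
    have "(1/2) *\<^sub>R x + (1/2) *\<^sub>R y \<in> C0"
      using convex[OF C0(1)] x(1) y(1) by (rule convexD) auto
    then have "J - d / 16 < S ((1/2) *\<^sub>R x + (1/2) *\<^sub>R y)"
      using I_le C0(2) by fastforce
    moreover have "c \<le> d"
      if "J - d / 16 < m" "c \<le> d / 2 + 2 * (a + b - 2 * m)" "a < J + d / 16" "b < J + d / 16"
      for a b c m
      using that by argo
    ultimately have "blinfun_apply \<mu> (clip u (sup x y) - clip u (inf x y)) \<le> d"
      using defect[of x y] x(2) y(3) by blast
    moreover have le: "\<bar>clip u x - clip u y\<bar> \<le> clip u (sup x y) - clip u (inf x y)"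
      by (rule abs_diff_clip_clip_le)
    ultimately have "blinfun_apply \<mu> \<bar>clip u x - clip u y\<bar> \<le> d"
      using blinfun_mono[OF \<mu>] order_trans by blast
    moreover have "\<bar>clip u x - clip u y\<bar> \<le> u + u"
      using abs_triangle_ineq4[of "clip u x" "clip u y"]
        add_mono[OF abs_clip_le[OF u(1), of x] abs_clip_le[OF u(1), of y]]
      by (rule order_trans)
    ultimately have "q \<bar>clip u x - clip u y\<bar> \<le> e / 3"
      by (intro ac) simp_all
    then have q2: "q (clip u x - clip u y) \<le> e / 3" by simp
    have q1: "q (z - clip u z) \<le> e / 3" if "z \<in> B" for z
      using q_abs_le[OF abs_diff_clip_le[of z u]] u(2)[OF that] by simp
    have "x - y = (x - clip u x) + ((clip u x - clip u y) + (clip u y - y))" by simp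
    then have "q (x - y) \<le> q (x - clip u x) + (q (clip u x - clip u y) + q (clip u y - y))"
      using q_add[of "x - clip u x" "(clip u x - clip u y) + (clip u y - y)"]
        q_add[of "clip u x - clip u y" "clip u y - y"] by simp
    also have "\<dots> \<le> e"
      using q1[OF xyB(1)] q2 q1[OF xyB(2)] q_minus_commute[of y "clip u y"] by simp
    finally show "\<exists>y\<in>D. q (x - y) \<le> e"
      using y(2) by blast
  qed
qed

end

section \<open>The weak topology\<close>

lemma openin_weak_topology_vimage: "open U \<Longrightarrow> openin weak_topology (blinfun_apply f -` U)"
  for f :: "'a::real_normed_vector \<Rightarrow>\<^sub>L real"
  unfolding weak_topology_def
  by (rule topology_generated_by_Basis, rule CollectI, rule exI[of _ f], rule exI[of _ U]) simp

lemma topspace_weak_topology [simp]: "topspace weak_topology = (UNIV :: 'a::real_normed_vector set)"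
proof -
  have "openin weak_topology (blinfun_apply (0 :: 'a \<Rightarrow>\<^sub>L real) -` UNIV)"
    by (rule openin_weak_topology_vimage) simp
  then show ?thesis
    by (auto dest: openin_subset)
qed

lemma limitin_weak_topology_iff:
  "limitin weak_topology x l F \<longleftrightarrow>
    (\<forall>f :: 'a \<Rightarrow>\<^sub>L real. ((\<lambda>n. blinfun_apply f (x n)) \<longlongrightarrow> blinfun_apply f l) F)"
  for l :: "'a::real_normed_vector"
proof (intro iffI allI)
  fix f :: "'a \<Rightarrow>\<^sub>L real"
  assume lim: "limitin weak_topology x l F"
  show "((\<lambda>n. blinfun_apply f (x n)) \<longlongrightarrow> blinfun_apply f l) F"
  proof (rule topological_tendstoI)
    fix U :: "real set" assume "open U" "blinfun_apply f l \<in> U"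
    then have "eventually (\<lambda>n. x n \<in> blinfun_apply f -` U) F"
      using lim openin_weak_topology_vimage[of U f] unfolding limitin_def by blast
    then show "eventually (\<lambda>n. blinfun_apply f (x n) \<in> U) F" by simp
  qed
next
  assume lim: "\<forall>f :: 'a \<Rightarrow>\<^sub>L real. ((\<lambda>n. blinfun_apply f (x n)) \<longlongrightarrow> blinfun_apply f l) F"
  have "l \<in> U \<longrightarrow> eventually (\<lambda>n. x n \<in> U) F" if "openin weak_topology U" for U
    using that unfolding weak_topology_def openin_topology_generated_by_iff
  proof (induction U rule: generate_topology_on.induct)
    case (Int U V)
    then show ?case by (auto elim: eventually_elim2)
  next
    case (UN \<U>)
    show ?case
    proof
      assume "l \<in> \<Union>\<U>"
      then obtain V where V: "V \<in> \<U>" "l \<in> V" by blast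
      with UN.IH have "eventually (\<lambda>n. x n \<in> V) F" by blast
      then show "eventually (\<lambda>n. x n \<in> \<Union>\<U>) F"
        by eventually_elim (use V in blast)
    qed
  next
    case (Basis U)
    then obtain f :: "'a \<Rightarrow>\<^sub>L real" and V where "U = blinfun_apply f -` V" "open V" by blast
    then show ?case
      using topological_tendstoD[OF lim[rule_format, of f], of V] by auto
  qed simp
  then show "limitin weak_topology x l F"
    by (simp add: limitin_def)
qed

lemma open_coordinate_balls:
  fixes \<xi> :: "'i \<Rightarrow> real"
  assumes "finite Z"
  shows "open {\<eta>. \<forall>z\<in>Z. \<bar>\<eta> z - \<xi> z\<bar> < d}"
proof -
  have "open {\<eta>. \<bar>\<eta> z - \<xi> z\<bar> < d}" for z
    by (intro open_Collect_less continuous_intros continuous_on_product_coordinates)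
  then have "open (\<Inter>z\<in>Z. {\<eta>. \<bar>\<eta> z - \<xi> z\<bar> < d})"
    using assms by (intro open_INT) auto
  moreover have "(\<Inter>z\<in>Z. {\<eta>. \<bar>\<eta> z - \<xi> z\<bar> < d}) = {\<eta>. \<forall>z\<in>Z. \<bar>\<eta> z - \<xi> z\<bar> < d}"
    by auto
  ultimately show ?thesis by simp
qed

lemma compact_coordinate_box: "compact (PiE UNIV (\<lambda>z. {- r z..r z :: real}))"
proof -
  have "compactin (product_topology (\<lambda>z. euclidean) UNIV) (PiE UNIV (\<lambda>z. {- r z..r z :: real}))"
    by (simp add: compactin_PiE)
  then show ?thesis
    by (simp add: euclidean_product_topology)
qed

lemma closed_coordinate_box: "closed (PiE UNIV (\<lambda>z. {- r z..r z :: real}))"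
proof -
  have "closedin (product_topology (\<lambda>z. euclidean) UNIV) (PiE UNIV (\<lambda>z. {- r z..r z :: real}))"
    by (simp add: closedin_product_topology)
  then show ?thesis
    by (simp add: euclidean_product_topology)
qed

text \<open>The Banach-Alaoglu theorem for a sequence: a product of intervals is compact, and
  linearity survives in the cluster point because each instance involves at most three coordinates.
  A subsequence need not converge, hence the form of the conclusion: approximation at arbitrarily
  late indices on each finite set.\<close>

lemma weak_star_cluster_point:
  fixes g :: "nat \<Rightarrow> 'a::real_normed_vector \<Rightarrow>\<^sub>L real"
  assumes bound: "\<And>k. norm (g k) \<le> M"
  obtains h :: "'a \<Rightarrow>\<^sub>L real"
  where "norm h \<le> M"
    "\<And>Z d N. finite Z \<Longrightarrow> 0 < d \<Longrightarrow> \<exists>k\<ge>N. \<forall>z\<in>Z. \<bar>blinfun_apply (g k) z - blinfun_apply h z\<bar> < d"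
proof -
  have M: "0 \<le> M" using bound[of 0] norm_ge_zero[of "g 0"] by linarith
  define X where "X = PiE UNIV (\<lambda>z::'a. {- (M * norm z)..M * norm z})"
  define F where "F = filtermap (\<lambda>k. blinfun_apply (g k)) sequentially"
  have X: "blinfun_apply (g k) \<in> X" for k
  proof -
    have "\<bar>blinfun_apply (g k) z\<bar> \<le> M * norm z" for z
      using norm_blinfun[of "g k" z] mult_right_mono[OF bound[of k] norm_ge_zero[of z]] by simp
    then have "- (M * norm z) \<le> blinfun_apply (g k) z \<and> blinfun_apply (g k) z \<le> M * norm z" for z
      by (simp add: abs_le_iff minus_le_iff)
    then show ?thesis by (simp add: X_def PiE_def Pi_def)
  qed
  have "compact X"
    unfolding X_def by (rule compact_coordinate_box)
  moreover have "F \<noteq> bot" by (simp add: F_def filtermap_bot_iff)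
  moreover have "eventually (\<lambda>\<eta>. \<eta> \<in> X) F" by (simp add: F_def eventually_filtermap X)
  ultimately obtain \<xi> where \<xi>: "\<xi> \<in> X" "inf (nhds \<xi>) F \<noteq> bot"
    unfolding compact_filter by blast
  have cluster: "\<exists>k\<ge>N. \<forall>z\<in>Z. \<bar>blinfun_apply (g k) z - \<xi> z\<bar> < d" if "finite Z" "0 < d" for Z d and N :: nat
  proof (rule ccontr)
    assume "\<not> ?thesis"
    then have no: "\<And>k. N \<le> k \<Longrightarrow> \<not> (\<forall>z\<in>Z. \<bar>blinfun_apply (g k) z - \<xi> z\<bar> < d)" by blast
    have "eventually (\<lambda>\<eta>. \<forall>z\<in>Z. \<bar>\<eta> z - \<xi> z\<bar> < d) (nhds \<xi>)"
      unfolding eventually_nhds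
      using open_coordinate_balls[OF \<open>finite Z\<close>, of \<xi> d] \<open>0 < d\<close>
      by (intro exI[of _ "{\<eta>. \<forall>z\<in>Z. \<bar>\<eta> z - \<xi> z\<bar> < d}"]) auto
    moreover have "eventually (\<lambda>\<eta>. \<not> (\<forall>z\<in>Z. \<bar>\<eta> z - \<xi> z\<bar> < d)) F"
      unfolding F_def eventually_filtermap eventually_sequentially using no by blast
    ultimately have "eventually (\<lambda>\<eta>. False) (inf (nhds \<xi>) F)"
      unfolding eventually_inf by blast
    with \<xi>(2) show False by simp
  qed
  have eq0: "a = 0" if "\<And>d. 0 < d \<Longrightarrow> \<bar>a\<bar> \<le> c * d" "0 < c" for a c :: real
  proof -
    have "\<bar>a\<bar> \<le> e" if "0 < e" for e
      using \<open>0 < c\<close> that \<open>\<And>d. 0 < d \<Longrightarrow> \<bar>a\<bar> \<le> c * d\<close>[of "e / c"] by simp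
    then have "\<bar>a\<bar> \<le> 0" using field_le_epsilon[of "\<bar>a\<bar>" 0] by simp
    then show ?thesis by simp
  qed
  have "linear \<xi>"
  proof (rule linearI)
    fix x y
    have "\<xi> (x + y) - (\<xi> x + \<xi> y) = 0"
    proof (rule eq0)
      fix d :: real assume "0 < d"
      then obtain k where "\<forall>z\<in>{x, y, x + y}. \<bar>blinfun_apply (g k) z - \<xi> z\<bar> < d"
        using cluster[of "{x, y, x + y}" d 0] by auto
      then show "\<bar>\<xi> (x + y) - (\<xi> x + \<xi> y)\<bar> \<le> 3 * d"
        by (simp add: blinfun.add_right) linarith
    qed simp
    then show "\<xi> (x + y) = \<xi> x + \<xi> y" by simp
  next
    fix c :: real and x
    have "\<xi> (c *\<^sub>R x) - c *\<^sub>R \<xi> x = 0"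
    proof (rule eq0)
      fix d :: real assume d: "0 < d"
      then obtain k where k: "\<forall>z\<in>{x, c *\<^sub>R x}. \<bar>blinfun_apply (g k) z - \<xi> z\<bar> < d"
        using cluster[of "{x, c *\<^sub>R x}" d 0] by auto
      then have "\<bar>c\<bar> * \<bar>blinfun_apply (g k) x - \<xi> x\<bar> \<le> \<bar>c\<bar> * d"
        by (intro mult_left_mono) auto
      then have "\<bar>c * blinfun_apply (g k) x - c * \<xi> x\<bar> \<le> \<bar>c\<bar> * d"
        by (simp flip: right_diff_distrib add: abs_mult)
      moreover have "\<bar>c * blinfun_apply (g k) x - \<xi> (c *\<^sub>R x)\<bar> < d"
        using k by (simp add: blinfun.scaleR_right)
      ultimately show "\<bar>\<xi> (c *\<^sub>R x) - c *\<^sub>R \<xi> x\<bar> \<le> (1 + \<bar>c\<bar>) * d"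
        by (simp add: algebra_simps abs_le_iff abs_less_iff)
    qed (simp add: add_pos_nonneg)
    then show "\<xi> (c *\<^sub>R x) = c *\<^sub>R \<xi> x" by simp
  qed
  have \<xi>_bound: "norm (\<xi> z) \<le> M * norm z" for z
    using \<xi>(1) by (auto simp: X_def PiE_def Pi_def abs_le_iff minus_le_iff)
  then have "bounded_linear \<xi>"
    using \<open>linear \<xi>\<close> by (intro bounded_linear.intro bounded_linear_axioms.intro exI[of _ M])
      (auto simp: mult.commute)
  then have app: "blinfun_apply (Blinfun \<xi>) = \<xi>"
    by (rule bounded_linear_Blinfun_apply)
  show thesis
  proof (rule that[of "Blinfun \<xi>"])
    show "norm (Blinfun \<xi>) \<le> M"
      using \<xi>_bound M by (intro norm_blinfun_bound) (auto simp: app)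
  qed (unfold app, rule cluster)
qed

text \<open>The weak closures of the tails of \<open>s\<close> have a common point by compactness.
  Its value under \<open>f\<close> is approached along every tail, hence is the limit whenever there
  is one.\<close>

lemma weak_cluster_point:
  fixes s :: "nat \<Rightarrow> 'b::real_normed_vector"
  assumes W: "relatively_weakly_compact W" and s: "\<And>n. s n \<in> W"
  obtains y where "\<And>(f :: 'b \<Rightarrow>\<^sub>L real) L. (\<lambda>n. blinfun_apply f (s n)) \<longlonglongrightarrow> L \<Longrightarrow> blinfun_apply f y = L"
proof -
  define C where "C N = weak_topology closure_of (s ` {N..})" for N :: nat
  have sC: "s n \<in> C N" if "N \<le> n" for n N
    using that closure_of_subset[of "s ` {N..}" weak_topology] by (auto simp: C_def)
  let ?W = "weak_topology closure_of W"
  have "?W \<inter> \<Inter>(range C) \<noteq> {}"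
  proof -
    have "?W \<inter> \<Inter>\<F> \<noteq> {}" if \<F>: "finite \<F>" "\<F> \<subseteq> range C" for \<F>
    proof -
      obtain I where I: "finite I" "\<F> = C ` I"
        using finite_subset_image[OF \<F>] by blast
      have "s (Max (insert 0 I)) \<in> \<Inter>\<F>"
        using I by (auto intro!: sC Max_ge)
      moreover have "s (Max (insert 0 I)) \<in> ?W"
        using s closure_of_subset[of W weak_topology] by auto
      ultimately show ?thesis by blast
    qed
    moreover have "\<forall>D\<in>range C. closedin weak_topology D"
      by (auto simp: C_def)
    ultimately show ?thesis
      using W unfolding relatively_weakly_compact_def compactin_fip by blast
  qed
  then obtain y where y: "y \<in> C N" for N by blast
  show thesis
  proof (rule that)
    fix f :: "'b \<Rightarrow>\<^sub>L real" and L
    assume lim: "(\<lambda>n. blinfun_apply f (s n)) \<longlonglongrightarrow> L"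
    have "dist (blinfun_apply f y) L \<le> 0 + e" if "0 < e" for e
    proof -
      obtain N where N: "\<And>n. N \<le> n \<Longrightarrow> dist (blinfun_apply f (s n)) L < e / 2"
        using lim \<open>0 < e\<close> unfolding lim_sequentially by (meson half_gt_zero)
      have "openin weak_topology (blinfun_apply f -` ball (blinfun_apply f y) (e / 2))"
        by (rule openin_weak_topology_vimage) simp
      moreover have "y \<in> blinfun_apply f -` ball (blinfun_apply f y) (e / 2)"
        using \<open>0 < e\<close> by simp
      ultimately have "\<exists>z\<in>s ` {N..}. z \<in> blinfun_apply f -` ball (blinfun_apply f y) (e / 2)"
        using y[of N] unfolding C_def in_closure_of by blast
      then obtain n where "N \<le> n" "dist (blinfun_apply f y) (blinfun_apply f (s n)) < e / 2"
        by (auto simp: dist_commute)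
      then show ?thesis
        using N[of n] dist_triangle[of "blinfun_apply f y" L "blinfun_apply f (s n)"] by simp
    qed
    then have "dist (blinfun_apply f y) L \<le> 0"
      by (rule field_le_epsilon)
    then show "blinfun_apply f y = L" by simp
  qed
qed

text \<open>The image of a Banach space in its bidual is norm closed: norming functionals turn
  uniform closeness on the dual into closeness in norm, so approximants for
  \<open>e = (1/2) ^ n\<close> form a Cauchy sequence, whose limit represents
  \<open>\<xi>\<close>.\<close>

lemma functional_in_range_if_approximable:
  fixes \<xi> :: "('b::banach \<Rightarrow>\<^sub>L real) \<Rightarrow> real"
  assumes approx: "\<And>e. 0 < e \<Longrightarrow> \<exists>x. \<forall>g. \<bar>blinfun_apply g x - \<xi> g\<bar> \<le> e * norm g"
  obtains y where "\<And>g. \<xi> g = blinfun_apply g y"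
proof -
  have "\<exists>x. \<forall>n g. \<bar>blinfun_apply g (x n) - \<xi> g\<bar> \<le> (1/2) ^ n * norm g"
    by (rule choice) (use approx in simp)
  then obtain x where x: "\<And>n g. \<bar>blinfun_apply g (x n) - \<xi> g\<bar> \<le> (1/2) ^ n * norm g" by blast
  have half: "(\<lambda>n. (1/2::real) ^ n) \<longlonglongrightarrow> 0"
    by (rule LIMSEQ_power_zero) simp
  have "Cauchy x"
  proof (rule metric_CauchyI)
    fix e :: real assume "0 < e"
    then obtain N where N: "\<And>n. N \<le> n \<Longrightarrow> (1/2::real) ^ n < e / 2"
      using order_tendstoD(2)[OF half, of "e / 2"] by (auto simp: eventually_sequentially)
    have "dist (x m) (x n) < e" if "N \<le> m" "N \<le> n" for m n
    proof -
      obtain g :: "'b \<Rightarrow>\<^sub>L real" where g: "norm g \<le> 1" "blinfun_apply g (x m - x n) = norm (x m - x n)"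
        using exists_norming_functional by blast
      have "\<bar>blinfun_apply g (x i) - \<xi> g\<bar> \<le> (1/2) ^ i" for i
        using x[of g i] by (rule order_trans) (rule mult_left_le, use g in simp_all)
      from this[of m] this[of n] N[OF that(1)] N[OF that(2)] g(2) show ?thesis
        unfolding dist_norm blinfun.diff_right by linarith
    qed
    then show "\<exists>N. \<forall>m\<ge>N. \<forall>n\<ge>N. dist (x m) (x n) < e" by blast
  qed
  then obtain y where y: "x \<longlonglongrightarrow> y"
    using Cauchy_convergent by (auto simp: convergent_def)
  show thesis
  proof (rule that)
    fix g :: "'b \<Rightarrow>\<^sub>L real"
    have "(\<lambda>n. (1/2) ^ n * norm g) \<longlonglongrightarrow> 0 * norm g"
      by (intro tendsto_mult half tendsto_const)
    then have "(\<lambda>n. blinfun_apply g (x n) - \<xi> g) \<longlonglongrightarrow> 0"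
      by (intro Lim_null_comparison[of "\<lambda>n. blinfun_apply g (x n) - \<xi> g"]) (use x in auto)
    then have "(\<lambda>n. blinfun_apply g (x n)) \<longlonglongrightarrow> \<xi> g"
      by (rule LIM_zero_cancel)
    moreover have "(\<lambda>n. blinfun_apply g (x n)) \<longlonglongrightarrow> blinfun_apply g y"
      using y by (intro tendsto_intros)
    ultimately show "\<xi> g = blinfun_apply g y"
      by (rule LIMSEQ_unique)
  qed
qed

text \<open>
  The weak topology is the topology of pointwise convergence on the dual, where bounded sets have
  compact closure by Tychonoff's theorem.
\<close>

lemma relatively_weakly_compactI:
  fixes W :: "'b::real_normed_vector set"
  assumes bounded: "\<And>x. x \<in> W \<Longrightarrow> norm x \<le> R"
    and cluster: "\<And>\<xi> :: ('b \<Rightarrow>\<^sub>L real) \<Rightarrow> real.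
      (\<And>G d. finite G \<Longrightarrow> 0 < d \<Longrightarrow> \<exists>x\<in>W. \<forall>g\<in>G. \<bar>blinfun_apply g x - \<xi> g\<bar> < d) \<Longrightarrow>
      \<exists>y. \<forall>g. \<xi> g = blinfun_apply g y"
  shows "relatively_weakly_compact W"
proof -
  define ev :: "'b \<Rightarrow> ('b \<Rightarrow>\<^sub>L real) \<Rightarrow> real" where "ev x = (\<lambda>g. blinfun_apply g x)" for x
  define X where "X = closure (ev ` W)"
  have "ev x \<in> PiE UNIV (\<lambda>g. {- (R * norm g)..R * norm g})" if "x \<in> W" for x
  proof -
    have "\<bar>blinfun_apply g x\<bar> \<le> R * norm g" for g
      using norm_blinfun[of g x] mult_left_mono[OF bounded[OF that] norm_ge_zero[of g]]
      by (simp add: mult.commute)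
    then have "- (R * norm g) \<le> blinfun_apply g x \<and> blinfun_apply g x \<le> R * norm g" for g
      by (simp add: abs_le_iff minus_le_iff)
    then show ?thesis by (simp add: ev_def PiE_def Pi_def)
  qed
  then have "X \<subseteq> PiE UNIV (\<lambda>g. {- (R * norm g)..R * norm g})"
    unfolding X_def by (intro closure_minimal closed_coordinate_box) auto
  moreover have "closed X"
    by (simp add: X_def)
  ultimately have "compact X"
    using compact_Int_closed[OF compact_coordinate_box] by (metis inf.absorb_iff2)
  have "\<exists>y. \<xi> = ev y" if "\<xi> \<in> X" for \<xi>
  proof -
    have "\<exists>y. \<forall>g. \<xi> g = blinfun_apply g y"
    proof (rule cluster)
      fix G :: "('b \<Rightarrow>\<^sub>L real) set" and d :: real assume "finite G" "0 < d"
      then show "\<exists>x\<in>W. \<forall>g\<in>G. \<bar>blinfun_apply g x - \<xi> g\<bar> < d"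
        using that open_coordinate_balls[of G \<xi> d]
        unfolding X_def closure_iff_nhds_not_empty
        by (elim allE[of _ "{\<eta>. \<forall>g\<in>G. \<bar>\<eta> g - \<xi> g\<bar> < d}"]) (fastforce simp: ev_def)
    qed
    then show ?thesis by (auto simp: ev_def)
  qed
  \<comment> \<open>\<open>r\<close> inverts evaluation on the compact set \<open>X\<close>.
    Composed with a functional it is a coordinate projection, so it is weakly continuous; its image
    is weakly compact and contains the weak closure of \<open>W\<close>.\<close>
  then obtain r where r: "\<And>\<xi>. \<xi> \<in> X \<Longrightarrow> ev (r \<xi>) = \<xi>" by metis
  have "continuous_map (subtopology euclidean X) weak_topology r"
    unfolding weak_topology_def
  proof (rule continuous_on_generated_topo)
    fix U assume "U \<in> {blinfun_apply f -` U |(f :: 'b \<Rightarrow>\<^sub>L real) U. open U}"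
    then obtain f :: "'b \<Rightarrow>\<^sub>L real" and V where U: "U = blinfun_apply f -` V" "open V" by blast
    have "blinfun_apply f (r \<xi>) = \<xi> f" if "\<xi> \<in> X" for \<xi>
      using r[OF that] unfolding ev_def by (rule fun_cong)
    then have "r -` U \<inter> X = {\<xi>. \<xi> f \<in> V} \<inter> X"
      by (auto simp: U)
    moreover have "open {\<xi> :: ('b \<Rightarrow>\<^sub>L real) \<Rightarrow> real. \<xi> f \<in> V}"
      using open_vimage[OF \<open>open V\<close> continuous_on_product_coordinates[of f]] by (simp add: vimage_def)
    ultimately show "openin (top_of_set X) (r -` U \<inter> topspace (top_of_set X))"
      by (auto simp: openin_open)
  next
    have "UNIV = blinfun_apply (0 :: 'b \<Rightarrow>\<^sub>L real) -` UNIV" by simp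
    then have "UNIV \<in> {blinfun_apply f -` U |(f :: 'b \<Rightarrow>\<^sub>L real) U. open U}"
      using open_UNIV by blast
    then show "r ` topspace (top_of_set X) \<subseteq> \<Union> {blinfun_apply f -` U |(f :: 'b \<Rightarrow>\<^sub>L real) U. open U}"
      by blast
  qed
  moreover have "compactin (top_of_set X) X"
    using \<open>compact X\<close> by (simp add: compactin_subtopology)
  ultimately have compact: "compactin weak_topology (r ` X)"
    by (rule image_compactin[rotated])
  have "weak_topology closure_of W \<subseteq> r ` X"
  proof
    fix y assume y: "y \<in> weak_topology closure_of W"
    have "continuous_map weak_topology euclidean ev"
    proof -
      have "continuous_map weak_topology euclidean (\<lambda>x. ev x g)" for g
        unfolding continuous_map_def
        using openin_weak_topology_vimage[of _ g] by (auto simp: ev_def vimage_def)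
      then show ?thesis
        unfolding euclidean_product_topology[symmetric] by (simp add: continuous_map_componentwise_UNIV)
    qed
    then have "ev y \<in> X"
      using y unfolding continuous_map_eq_image_closure_subset X_def by auto
    moreover have "y = r (ev y)"
    proof -
      obtain g :: "'b \<Rightarrow>\<^sub>L real" where g: "blinfun_apply g (y - r (ev y)) = norm (y - r (ev y))"
        using exists_norming_functional by metis
      have "blinfun_apply g (r (ev y)) = blinfun_apply g y"
        using r[OF \<open>ev y \<in> X\<close>] by (metis ev_def)
      with g show ?thesis by (simp add: blinfun.diff_right)
    qed
    ultimately show "y \<in> r ` X" by blast
  qed
  then show ?thesis
    unfolding relatively_weakly_compact_def by (intro closed_compactin[OF compact] closedin_closure_of)
qed

section \<open>\<open>b\<close>-weakly compact operators\<close>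

lemma q_seminorm_upper: "\<bar>y\<bar> \<le> \<bar>x\<bar> \<Longrightarrow> norm (blinfun_apply T y) \<le> q_seminorm T x"
  unfolding q_seminorm_def by (rule cSUP_upper[OF _ bdd_above_q_seminorm]) simp

lemma q_seminorm_least:
  "(\<And>y. \<bar>y\<bar> \<le> \<bar>x\<bar> \<Longrightarrow> norm (blinfun_apply T y) \<le> r) \<Longrightarrow> q_seminorm T x \<le> r"
  unfolding q_seminorm_def by (rule cSUP_least) auto

text \<open>Subadditivity rests on the Riesz decomposition: an element below
  \<open>\<bar>x\<bar> + \<bar>y\<bar>\<close> splits into competitors for the suprema at
  \<open>x\<close> and at \<open>y\<close>. Homogeneity for nonzero \<open>c\<close> is one
  inequality applied to \<open>c\<close> and to \<open>1 / c\<close>.\<close>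

lemma lattice_seminorm_q_seminorm: "lattice_seminorm (q_seminorm T) (norm T)"
  for T :: "'a::banach_lattice \<Rightarrow>\<^sub>L 'b::banach"
proof
  have scale_le: "q_seminorm T (c *\<^sub>R x) \<le> \<bar>c\<bar> * q_seminorm T x" for c x
  proof (rule q_seminorm_least)
    fix y assume y: "\<bar>y\<bar> \<le> \<bar>c *\<^sub>R x\<bar>"
    show "norm (blinfun_apply T y) \<le> \<bar>c\<bar> * q_seminorm T x"
    proof (cases "c = 0")
      case True
      with y have "y = 0" by simp
      with True show ?thesis by (simp add: blinfun.zero_right)
    next
      case False
      have "\<bar>(1 / c) *\<^sub>R y\<bar> = \<bar>1 / c\<bar> *\<^sub>R \<bar>y\<bar>"
        by (rule abs_scaleR)
      also have "\<dots> \<le> \<bar>1 / c\<bar> *\<^sub>R \<bar>c *\<^sub>R x\<bar>"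
        using y by (rule scaleR_left_mono) simp
      also have "\<dots> = \<bar>x\<bar>"
        using False by (simp add: abs_scaleR[of c x])
      finally have "norm (blinfun_apply T ((1 / c) *\<^sub>R y)) \<le> q_seminorm T x"
        by (rule q_seminorm_upper)
      then show ?thesis
        using False by (simp add: blinfun.scaleR_right field_simps)
    qed
  qed
  show "q_seminorm T (c *\<^sub>R x) = \<bar>c\<bar> * q_seminorm T x" for c x
  proof (cases "c = 0")
    case True
    have "q_seminorm T 0 \<le> 0"
      by (rule q_seminorm_least) (simp add: blinfun.zero_right)
    moreover have "0 \<le> q_seminorm T 0"
      using q_seminorm_upper[of 0 0 T] by (simp add: blinfun.zero_right)
    ultimately show ?thesis using True by simp
  next
    case False
    have "q_seminorm T x \<le> \<bar>1 / c\<bar> * q_seminorm T (c *\<^sub>R x)"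
      using scale_le[of "1 / c" "c *\<^sub>R x"] False by simp
    then show ?thesis
      using scale_le[of c x] False by (simp add: field_simps)
  qed
  show "q_seminorm T x \<le> q_seminorm T y" if "\<bar>x\<bar> \<le> \<bar>y\<bar>" for x y
    using that by (intro q_seminorm_least q_seminorm_upper) (rule order_trans)
  show "q_seminorm T (x + y) \<le> q_seminorm T x + q_seminorm T y" for x y
  proof (rule q_seminorm_least)
    fix z assume "\<bar>z\<bar> \<le> \<bar>x + y\<bar>"
    then have "\<bar>z\<bar> \<le> \<bar>x\<bar> + \<bar>y\<bar>"
      using abs_triangle_ineq by (rule order_trans)
    then obtain z1 z2 where z: "z = z1 + z2" "\<bar>z1\<bar> \<le> \<bar>x\<bar>" "\<bar>z2\<bar> \<le> \<bar>y\<bar>"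
      by (rule riesz_decomposition)
    have "norm (blinfun_apply T z) \<le> norm (blinfun_apply T z1) + norm (blinfun_apply T z2)"
      unfolding z(1) blinfun.add_right by (rule norm_triangle_ineq)
    also have "\<dots> \<le> q_seminorm T x + q_seminorm T y"
      using z by (intro add_mono q_seminorm_upper)
    finally show "norm (blinfun_apply T z) \<le> q_seminorm T x + q_seminorm T y" .
  qed
  show "q_seminorm T x \<le> norm T * norm x" for x
  proof (rule q_seminorm_least)
    fix y :: 'a assume "\<bar>y\<bar> \<le> \<bar>x\<bar>"
    then have "norm T * norm y \<le> norm T * norm x"
      by (intro mult_left_mono norm_lattice_mono) auto
    with norm_blinfun[of T y] show "norm (blinfun_apply T y) \<le> norm T * norm x"
      by linarith
  qed
qed simp

text \<open>The trace on the lattice of the order interval from \<open>0\<close> to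
  \<open>\<Phi>\<close> in the bidual. It is solid and norm bounded, as
  \<open>approximately_order_bounded\<close> requires.\<close>

definition bidual_interval :: "(('a::banach_lattice \<Rightarrow>\<^sub>L real) \<Rightarrow>\<^sub>L real) \<Rightarrow> 'a set"
  where "bidual_interval \<Phi> = {x. 0 \<le> x \<and> bidual_embedding x \<le> \<Phi>}"

lemma bidual_interval_solid:
  "x \<in> bidual_interval \<Phi> \<Longrightarrow> 0 \<le> y \<Longrightarrow> y \<le> x \<Longrightarrow> y \<in> bidual_interval \<Phi>"
  unfolding bidual_interval_def mem_Collect_eq
  by (meson bidual_embedding_mono order_trans)

lemma atLeastAtMost_subset_bidual_interval: "{0..u} \<subseteq> bidual_interval (bidual_embedding u)"
  by (auto simp: bidual_interval_def bidual_embedding_mono)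

lemma norm_le_if_mem_bidual_interval: "x \<in> bidual_interval \<Phi> \<Longrightarrow> norm x \<le> norm \<Phi>"
  by (auto simp: bidual_interval_def intro: norm_le_if_bidual_embedding_le)

lemma b_order_bounded_nonneg_iff:
  assumes "\<And>x. x \<in> A \<Longrightarrow> 0 \<le> x"
  shows "b_order_bounded A \<longleftrightarrow> (\<exists>\<Phi>. A \<subseteq> bidual_interval \<Phi>)"
proof -
  have "bdd_below (bidual_embedding ` A)"
    using assms bidual_embedding_mono by (intro bdd_belowI2[of _ "bidual_embedding 0"]) auto
  then show ?thesis
    unfolding b_order_bounded_def bdd_above_def bidual_interval_def using assms by auto
qed

text \<open>A sum of disjoint positive elements is their supremum, so the bound
  \<open>\<Phi>\<close> passes to it unchanged.\<close>

lemma disjoint_sum_mem_bidual_interval: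
  assumes "disjoint_seq x" "range x \<subseteq> bidual_interval \<Phi>"
  shows "(\<Sum>n<N. x n) \<in> bidual_interval \<Phi>"
proof -
  have x: "0 \<le> x n" "bidual_embedding (x n) \<le> \<Phi>" for n
    using assms(2) by (auto simp: bidual_interval_def)
  have disj: "inf (\<Sum>n<N. x n) (x m) = 0" if "N \<le> m" for N m
    using that
  proof (induction N)
    case 0
    then show ?case using x(1) by (simp add: inf_absorb1)
  next
    case (Suc N)
    have "inf ((\<Sum>n<N. x n) + x N) (x m) \<le> inf (\<Sum>n<N. x n) (x m) + inf (x N) (x m)"
      using x(1) by (intro inf_add_le sum_nonneg) auto
    also have "\<dots> = 0"
      using Suc assms(1) x(1) by (simp add: disjoint_seq_def)
    finally show ?case
      using x(1) by (intro antisym) (auto simp: sum_nonneg add_nonneg_nonneg)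
  qed
  have "bidual_embedding (\<Sum>n<N. x n) \<le> \<Phi>"
  proof (induction N)
    case 0
    show ?case
      using bidual_embedding_mono[OF x(1)[of 0]] x(2)[of 0] by (simp add: order_trans)
  next
    case (Suc N)
    have "(\<Sum>n<Suc N. x n) = sup (\<Sum>n<N. x n) (x N)"
      using add_eq_inf_sup[of "\<Sum>n<N. x n" "x N"] disj[of N N] by simp
    with Suc x(2) show ?case
      by (simp only: bidual_embedding_sup_le)
  qed
  with x(1) show ?thesis
    by (simp add: bidual_interval_def sum_nonneg)
qed

text \<open>With the signs of \<open>f (x n)\<close> as coefficients, the partial sums have modulus
  below the unsigned ones, whose norm is at most \<open>norm \<Phi>\<close>; applying
  \<open>f\<close> bounds the sums of absolute values.\<close>

lemma summable_disjoint:
  fixes f :: "'a::banach_lattice \<Rightarrow>\<^sub>L real"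
  assumes "disjoint_seq x" "range x \<subseteq> bidual_interval \<Phi>"
  shows "summable (\<lambda>n. \<bar>blinfun_apply f (x n)\<bar>)"
proof (rule bounded_imp_summable)
  have x: "0 \<le> x n" for n
    using assms(2) by (auto simp: bidual_interval_def)
  fix N
  define s where "s n = sgn (blinfun_apply f (x n)) *\<^sub>R x n" for n
  have "\<bar>s n\<bar> \<le> x n" for n
    using x[of n] by (auto simp: s_def abs_scaleR sgn_real_def)
  then have "\<bar>\<Sum>n\<le>N. s n\<bar> \<le> (\<Sum>n\<le>N. x n)"
    by (induction N) (auto intro: order_trans[OF abs_triangle_ineq] add_mono)
  also have "\<dots> = \<bar>\<Sum>n<Suc N. x n\<bar>"
    using x by (simp add: sum_nonneg lessThan_Suc_atMost)
  finally have norm_s: "norm (\<Sum>n\<le>N. s n) \<le> norm \<Phi>"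
    using norm_lattice_mono norm_le_if_mem_bidual_interval[OF disjoint_sum_mem_bidual_interval[OF assms]]
      order_trans by blast
  have "(\<Sum>n\<le>N. \<bar>blinfun_apply f (x n)\<bar>) = blinfun_apply f (\<Sum>n\<le>N. s n)"
    by (simp add: s_def blinfun.sum_right blinfun.scaleR_right abs_sgn mult.commute)
  also have "\<dots> \<le> norm f * norm (\<Sum>n\<le>N. s n)"
    using norm_blinfun[of f "\<Sum>n\<le>N. s n"] by simp
  also have "\<dots> \<le> norm f * norm \<Phi>"
    using norm_s by (rule mult_left_mono) simp
  finally show "(\<Sum>n\<le>N. \<bar>blinfun_apply f (x n)\<bar>) \<le> norm f * norm \<Phi>" .
qed simp

text \<open>Truncation at \<open>u\<close> keeps the sequence disjoint and moves it into
  \<open>{0..u}\<close>, where every functional is summable along it.\<close>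

lemma disjoint_imp_uaw_null:
  fixes x :: "nat \<Rightarrow> 'a::banach_lattice"
  assumes "disjoint_seq x"
  shows "uaw_null x"
  unfolding uaw_null_def limitin_weak_topology_iff
proof (intro allI impI)
  fix u :: 'a and f :: "'a \<Rightarrow>\<^sub>L real"
  assume u: "0 \<le> u"
  define y where "y n = inf \<bar>x n\<bar> u" for n
  have y: "0 \<le> y n" "y n \<le> \<bar>x n\<bar>" "y n \<le> u" for n
    using u by (auto simp: y_def)
  have "disjoint_seq y"
    using assms y(1,2) by (rule disjoint_seq_mono)
  moreover have "range y \<subseteq> bidual_interval (bidual_embedding u)"
    using y atLeastAtMost_subset_bidual_interval by force
  ultimately have "summable (\<lambda>n. \<bar>blinfun_apply f (y n)\<bar>)"
    by (rule summable_disjoint)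
  then have "(\<lambda>n. blinfun_apply f (y n)) \<longlonglongrightarrow> 0"
    using summable_LIMSEQ_zero tendsto_rabs_zero_iff by blast
  then show "(\<lambda>n. blinfun_apply f (inf \<bar>x n\<bar> u)) \<longlonglongrightarrow> blinfun_apply f 0"
    by (simp add: y_def blinfun.zero_right)
qed

section \<open>Consequences of assertion (4)\<close>

context
  fixes T :: "'a::banach_lattice \<Rightarrow>\<^sub>L 'b::banach"
begin

interpretation q: lattice_seminorm "q_seminorm T" "norm T"
  by (rule lattice_seminorm_q_seminorm)

text \<open>A nearly optimal \<open>y n\<close> in the supremum defining
  \<open>q_seminorm T (x n)\<close> has positive and negative parts below \<open>x n\<close>. Both
  form disjoint sequences in the same solid set, so the assumption applies to each.\<close>

lemma disjoint_null_bidual_interval: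
  assumes null: "\<And>x. disjoint_seq x \<Longrightarrow> range x \<subseteq> bidual_interval \<Phi> \<Longrightarrow>
    (\<lambda>n. norm (blinfun_apply T (x n))) \<longlonglongrightarrow> 0"
  shows "q.disjoint_null (bidual_interval \<Phi>)"
  unfolding q.disjoint_null_def
proof (intro allI impI)
  fix x assume x: "range x \<subseteq> bidual_interval \<Phi>" "disjoint_seq x"
  have "\<exists>y. \<bar>y\<bar> \<le> \<bar>x n\<bar> \<and> q_seminorm T (x n) - (1/2) ^ n < norm (blinfun_apply T y)" for n
  proof (rule ccontr)
    assume "\<not> ?thesis"
    then have "q_seminorm T (x n) \<le> q_seminorm T (x n) - (1/2) ^ n"
      by (intro q_seminorm_least) (auto simp: not_less)
    moreover have "(0::real) < (1/2) ^ n" by simp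
    ultimately show False by linarith
  qed
  then obtain y where y: "\<And>n. \<bar>y n\<bar> \<le> \<bar>x n\<bar>"
    "\<And>n. q_seminorm T (x n) - (1/2) ^ n < norm (blinfun_apply T (y n))"
    by metis
  have x0: "\<bar>x n\<bar> = x n" "x n \<in> bidual_interval \<Phi>" for n
  proof -
    show "x n \<in> bidual_interval \<Phi>"
      using x(1) by blast
    then show "\<bar>x n\<bar> = x n"
      by (simp add: bidual_interval_def)
  qed
  have part: "(\<lambda>n. norm (blinfun_apply T (z n))) \<longlonglongrightarrow> 0"
    if z: "\<And>n. 0 \<le> z n" "\<And>n. z n \<le> \<bar>x n\<bar>" for z
  proof (rule null)
    show "disjoint_seq z"
      using x(2) z by (rule disjoint_seq_mono)
    show "range z \<subseteq> bidual_interval \<Phi>"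
      using z x0 bidual_interval_solid by (metis image_subsetI)
  qed
  have le: "pprt z \<le> \<bar>x n\<bar>" if "\<bar>z\<bar> \<le> \<bar>x n\<bar>" for z n
    using order_trans[OF abs_pprt_le that] by simp
  have "(\<lambda>n. norm (blinfun_apply T (pprt (y n))) + norm (blinfun_apply T (pprt (- y n))) + (1/2) ^ n)
      \<longlonglongrightarrow> 0 + 0 + 0"
    using y(1) by (intro tendsto_add part le LIMSEQ_power_zero) auto
  then have lim: "(\<lambda>n. norm (blinfun_apply T (pprt (y n))) + norm (blinfun_apply T (pprt (- y n))) + (1/2) ^ n)
      \<longlonglongrightarrow> 0" by simp
  have "q_seminorm T (x n)
      \<le> norm (blinfun_apply T (pprt (y n))) + norm (blinfun_apply T (pprt (- y n))) + (1/2) ^ n" for n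
  proof -
    have "norm (blinfun_apply T (y n)) = norm (blinfun_apply T (pprt (y n)) - blinfun_apply T (pprt (- y n)))"
      by (simp flip: blinfun.diff_right add: pprt_diff_pprt_minus)
    also have "\<dots> \<le> norm (blinfun_apply T (pprt (y n))) + norm (blinfun_apply T (pprt (- y n)))"
      by (rule norm_triangle_ineq4)
    finally show ?thesis
      using y(2)[of n] by linarith
  qed
  then show "(\<lambda>n. q_seminorm T (x n)) \<longlonglongrightarrow> 0"
    by (intro tendsto_sandwich[OF _ _ tendsto_const lim]) auto
qed

lemma disjoint_null_mono: "q.disjoint_null D \<Longrightarrow> D' \<subseteq> D \<Longrightarrow> q.disjoint_null D'"
  unfolding q.disjoint_null_def by blast

context
  assumes null: "\<And>\<Phi>. q.disjoint_null (bidual_interval \<Phi>)"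
begin

lemma disjoint_null_order_interval: "q.disjoint_null {0..u}"
  using null atLeastAtMost_subset_bidual_interval by (rule disjoint_null_mono)

lemma bidual_interval_tight:
  assumes "0 < e"
  obtains u where "0 \<le> u" "\<And>x. x \<in> bidual_interval \<Phi> \<Longrightarrow> q_seminorm T (pprt (x - u)) \<le> e"
proof (rule q.approximately_order_bounded[of "bidual_interval \<Phi>" "norm \<Phi>" e])
  show "0 \<le> x" if "x \<in> bidual_interval \<Phi>" for x
    using that by (simp add: bidual_interval_def)
qed (auto intro: bidual_interval_solid norm_le_if_mem_bidual_interval null assms that)

text \<open>The excess of \<open>x n\<close> over \<open>u\<close> is small by tightness; on the
  remaining part \<open>inf (x n) u\<close> the functional \<open>\<mu>\<close> tends to zero, which
  makes \<open>q\<close> small there.\<close>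

lemma uaw_null_imp_q_seminorm_tendsto_zero:
  assumes x: "range x \<subseteq> bidual_interval \<Phi>" and uaw: "uaw_null x"
  shows "(\<lambda>n. q_seminorm T (x n)) \<longlonglongrightarrow> 0"
proof (rule LIMSEQ_I)
  fix e :: real assume "0 < e"
  then have e: "0 < e / 3" by simp
  obtain u where u: "0 \<le> u" "\<And>x. x \<in> bidual_interval \<Phi> \<Longrightarrow> q_seminorm T (pprt (x - u)) \<le> e / 3"
    using bidual_interval_tight[OF e] by metis
  obtain \<mu> :: "'a \<Rightarrow>\<^sub>L real" and d where d: "0 < d"
    and ac: "\<And>w. w \<in> {0..u} \<Longrightarrow> blinfun_apply \<mu> w \<le> d \<Longrightarrow> q_seminorm T w \<le> e / 3"
    using q.absolutely_continuous[OF disjoint_null_order_interval e] by metis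
  have x0: "0 \<le> x n" "x n \<in> bidual_interval \<Phi>" for n
    using x by (auto simp: bidual_interval_def)
  have "(\<lambda>n. blinfun_apply \<mu> (inf \<bar>x n\<bar> u)) \<longlonglongrightarrow> blinfun_apply \<mu> 0"
    using uaw u(1) unfolding uaw_null_def limitin_weak_topology_iff by blast
  then have "(\<lambda>n. blinfun_apply \<mu> (inf (x n) u)) \<longlonglongrightarrow> 0"
    using x0 by (simp add: blinfun.zero_right)
  then have "eventually (\<lambda>n. blinfun_apply \<mu> (inf (x n) u) < d) sequentially"
    using d by (intro order_tendstoD) auto
  then have "eventually (\<lambda>n. norm (q_seminorm T (x n) - 0) < e) sequentially"
  proof eventually_elim
    case (elim n)
    have "q_seminorm T (x n) \<le> q_seminorm T (inf (x n) u) + q_seminorm T (pprt (x n - u))"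
      using q.q_add[of "inf (x n) u" "pprt (x n - u)"] by (simp add: inf_plus_pprt_diff)
    moreover have "q_seminorm T (inf (x n) u) \<le> e / 3"
      using elim x0(1)[of n] u(1) by (intro ac) auto
    moreover have "q_seminorm T (pprt (x n - u)) \<le> e / 3"
      using x0(2) by (rule u(2))
    ultimately show ?case
      using \<open>0 < e\<close> by simp
  qed
  then show "\<exists>no. \<forall>n\<ge>no. norm (q_seminorm T (x n) - 0) < e"
    by (simp add: eventually_sequentially)
qed

lemma b_weakly_compact_if_disjoint_null: "b_weakly_compact T"
  unfolding b_weakly_compact_def
proof (intro allI impI)
  fix A :: "'a set" assume A: "b_order_bounded A"
  obtain \<Psi> \<Phi> where bounds: "\<And>x. x \<in> A \<Longrightarrow> \<Psi> \<le> bidual_embedding x"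
    "\<And>x. x \<in> A \<Longrightarrow> bidual_embedding x \<le> \<Phi>"
    using A unfolding b_order_bounded_def bdd_below_def bdd_above_def by auto
  \<comment> \<open>\<open>A\<close> need not be convex, but this enlargement within the same bounds
    is.\<close>
  define B where "B = {x. \<Psi> \<le> bidual_embedding x \<and> bidual_embedding x \<le> \<Phi>}"
  have "A \<subseteq> B" using bounds by (auto simp: B_def)
  show "relatively_weakly_compact (blinfun_apply T ` A)"
  proof (cases "A = {}")
    case True
    then show ?thesis by (simp add: relatively_weakly_compact_def)
  next
    case False
    then obtain x0 where "x0 \<in> B" using \<open>A \<subseteq> B\<close> by blast
    define \<Theta> where "\<Theta> = \<Phi> - \<Psi>"
    \<comment> \<open>Recentring at \<open>x0\<close> reduces to positive elements:
      \<open>x - x0\<close> and its negative both lie below \<open>\<Phi> - \<Psi>\<close>, hence so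
      does their supremum.\<close>
    have near: "\<bar>x - x0\<bar> \<in> bidual_interval \<Theta>" if "x \<in> B" for x
    proof -
      have "bidual_embedding (y - z) \<le> \<Theta>" if "y \<in> B" "z \<in> B" for y z
        using that unfolding B_def \<Theta>_def bidual_embedding_le_iff le_bidual_embedding_iff mem_Collect_eq
        by (auto simp: blinfun.diff_right blinfun.diff_left intro: diff_mono)
      from this[of x x0] this[of x0 x] have "bidual_embedding (sup (x - x0) (- (x - x0))) \<le> \<Theta>"
        using that \<open>x0 \<in> B\<close> by (intro bidual_embedding_sup_le) simp_all
      then have "bidual_embedding \<bar>x - x0\<bar> \<le> \<Theta>"
        by (simp only: abs_lattice[of "x - x0"])
      then show ?thesis
        by (simp add: bidual_interval_def)
    qed
    have norm_B: "norm x \<le> norm \<Theta> + norm x0" if "x \<in> B" for x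
    proof -
      have "norm (x - x0) \<le> norm \<bar>x - x0\<bar>"
        by (rule norm_lattice_mono) simp
      also have "\<dots> \<le> norm \<Theta>"
        using near[OF that] by (rule norm_le_if_mem_bidual_interval)
      finally show ?thesis
        using norm_triangle_ineq[of "x - x0" x0] by simp
    qed
    have convex_B: "convex B"
    proof (rule convexI)
      fix x y and s t :: real
      assume xy: "x \<in> B" "y \<in> B" and st: "0 \<le> s" "0 \<le> t" "s + t = 1"
      have split: "c = s * c + t * c" for c :: real
        using st(3) by (simp flip: distrib_right)
      show "s *\<^sub>R x + t *\<^sub>R y \<in> B"
        unfolding B_def mem_Collect_eq bidual_embedding_le_iff le_bidual_embedding_iff
          blinfun.add_right blinfun.scaleR_right real_scaleR_def
      proof (intro conjI allI impI)
        fix f :: "'a \<Rightarrow>\<^sub>L real" assume f: "0 \<le> f"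
        have "blinfun_apply \<Psi> f \<le> blinfun_apply f z \<and> blinfun_apply f z \<le> blinfun_apply \<Phi> f" if "z \<in> B" for z
          using that f unfolding B_def bidual_embedding_le_iff le_bidual_embedding_iff by blast
        note this[OF xy(1)] this[OF xy(2)]
        then show "blinfun_apply \<Psi> f \<le> s * blinfun_apply f x + t * blinfun_apply f y"
          "s * blinfun_apply f x + t * blinfun_apply f y \<le> blinfun_apply \<Phi> f"
          using split[of "blinfun_apply \<Psi> f"] split[of "blinfun_apply \<Phi> f"] st(1,2)
          by (auto intro: add_mono mult_left_mono order_trans[OF eq_refl[OF split]] order_trans[OF _ eq_refl[OF split[symmetric]]])
      qed
    qed
    have tight: "\<exists>u\<ge>0. \<forall>x\<in>B. q_seminorm T (pprt (\<bar>x\<bar> - u)) \<le> e" if "0 < e" for e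
    proof -
      obtain u where u: "0 \<le> u" "\<And>x. x \<in> bidual_interval \<Theta> \<Longrightarrow> q_seminorm T (pprt (x - u)) \<le> e"
        using bidual_interval_tight[OF \<open>0 < e\<close>] by metis
      have "q_seminorm T (pprt (\<bar>x\<bar> - (u + \<bar>x0\<bar>))) \<le> e" if "x \<in> B" for x
      proof -
        have "\<bar>x\<bar> - \<bar>x0\<bar> \<le> \<bar>x - x0\<bar>"
          by (rule abs_triangle_ineq2)
        then have "\<bar>x\<bar> - (u + \<bar>x0\<bar>) \<le> \<bar>x - x0\<bar> - u"
          by (simp add: algebra_simps)
        then have "q_seminorm T (pprt (\<bar>x\<bar> - (u + \<bar>x0\<bar>))) \<le> q_seminorm T (pprt (\<bar>x - x0\<bar> - u))"
          by (intro q.q_mono_nonneg pprt_mono) auto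
        with u(2)[OF near[OF that]] show ?thesis by simp
      qed
      with u(1) show ?thesis
        by (intro exI[of _ "u + \<bar>x0\<bar>"]) (simp add: add_nonneg_nonneg)
    qed
    show ?thesis
    proof (rule relatively_weakly_compactI)
      show "norm y \<le> norm T * (norm \<Theta> + norm x0)" if "y \<in> blinfun_apply T ` A" for y
      proof -
        obtain x where x: "x \<in> B" "y = blinfun_apply T x"
          using \<open>y \<in> blinfun_apply T ` A\<close> \<open>A \<subseteq> B\<close> by blast
        have "norm T * norm x \<le> norm T * (norm \<Theta> + norm x0)"
          using norm_B[OF x(1)] by (rule mult_left_mono) simp
        with norm_blinfun[of T x] show ?thesis
          unfolding x(2) by (rule order_trans)
      qed
    next
      fix \<xi> :: "('b \<Rightarrow>\<^sub>L real) \<Rightarrow> real"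
      assume cluster: "\<And>G d. finite G \<Longrightarrow> 0 < d \<Longrightarrow>
        \<exists>y\<in>blinfun_apply T ` A. \<forall>g\<in>G. \<bar>blinfun_apply g y - \<xi> g\<bar> < d"
      \<comment> \<open>Points whose images are close to \<open>\<xi>\<close> at finitely many
        functionals. These sets meet \<open>A\<close> because \<open>\<xi>\<close> is a cluster
        point of its image; unions of the \<open>G\<close> and minima of the \<open>d\<close> make
        them directed.\<close>
      define C where "C G d = {x\<in>B. \<forall>g\<in>G. \<bar>blinfun_apply g (blinfun_apply T x) - \<xi> g\<bar> \<le> d}" for G d
      define \<C> where "\<C> = {C G d |G d. finite G \<and> 0 < d}"
      have C_mem: "C G d \<in> \<C>" if "finite G" "0 < d" for G d
        using that unfolding \<C>_def by blast
      have C_cases: "\<exists>G d. D = C G d \<and> finite G \<and> 0 < d" if "D \<in> \<C>" for D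
        using that unfolding \<C>_def by blast
      have "\<exists>y. \<forall>g. \<bar>blinfun_apply g y - \<xi> g\<bar> \<le> e * norm g" if "0 < e" for e
      proof -
        obtain x where x: "x \<in> B" "\<And>D. D \<in> \<C> \<Longrightarrow> \<exists>y\<in>D. q_seminorm T (x - y) \<le> e"
        proof (rule q.directed_convex_approximation[of \<C> B "norm \<Theta> + norm x0" e])
          show "\<C> \<noteq> {}" using C_mem[of "{}" 1] by auto
          show "D \<noteq> {}" if "D \<in> \<C>" for D
          proof -
            obtain G d where D: "D = C G d" "finite G" "0 < d"
              using C_cases[OF \<open>D \<in> \<C>\<close>] by blast
            then obtain x where "x \<in> A" "\<forall>g\<in>G. \<bar>blinfun_apply g (blinfun_apply T x) - \<xi> g\<bar> < d"
              using cluster by blast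
            then have "x \<in> D"
              using \<open>A \<subseteq> B\<close> by (auto simp: D(1) C_def intro: less_imp_le)
            then show ?thesis by blast
          qed
          show "convex D" if "D \<in> \<C>" for D
          proof -
            obtain G d where D: "D = C G d"
              using C_cases[OF \<open>D \<in> \<C>\<close>] by blast
            have "D = B \<inter> (\<Inter>g\<in>G. (\<lambda>x. blinfun_apply g (blinfun_apply T x)) -` {\<xi> g - d..\<xi> g + d})"
              by (auto simp: D C_def abs_le_iff algebra_simps)
            moreover have "linear (\<lambda>x. blinfun_apply g (blinfun_apply T x))" for g :: "'b \<Rightarrow>\<^sub>L real"
              by (intro linearI) (simp_all add: blinfun.add_right blinfun.scaleR_right)
            ultimately show ?thesis
              by (auto intro!: convex_Int convex_B convex_INT convex_linear_vimage)
          qed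
          show "D \<subseteq> B" if "D \<in> \<C>" for D
            using C_cases[OF that] by (auto simp: C_def)
          show "\<exists>E\<in>\<C>. E \<subseteq> D \<inter> D'" if D: "D \<in> \<C>" "D' \<in> \<C>" for D D'
          proof -
            obtain G d G' d' where "D = C G d" "finite G" "0 < d" "D' = C G' d'" "finite G'" "0 < d'"
              using C_cases[OF D(1)] C_cases[OF D(2)] by blast
            then show ?thesis
              by (intro bexI[of _ "C (G \<union> G') (min d d')"] C_mem) (auto simp: C_def)
          qed
        qed (use \<open>0 < e\<close> that disjoint_null_order_interval norm_B tight in auto)
        have "\<bar>blinfun_apply g (blinfun_apply T x) - \<xi> g\<bar> \<le> e * norm g" for g
        proof (rule field_le_epsilon)
          fix d :: real assume "0 < d"
          \<comment> \<open>\<open>x\<close> serves all \<open>g\<close> at once, whereas the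
            intermediate \<open>y\<close> may depend on \<open>g\<close> and
            \<open>d\<close>.\<close>
          then obtain y where y: "y \<in> C {g} d" "q_seminorm T (x - y) \<le> e"
            using x(2) C_mem[of "{g}" d] by blast
          have "\<bar>blinfun_apply g (blinfun_apply T (x - y))\<bar> \<le> norm g * norm (blinfun_apply T (x - y))"
            using norm_blinfun[of g "blinfun_apply T (x - y)"] by simp
          also have "\<dots> \<le> norm g * e"
            using q_seminorm_upper[of "x - y" "x - y" T] y(2) by (intro mult_left_mono) auto
          finally have "\<bar>blinfun_apply g (blinfun_apply T (x - y))\<bar> \<le> norm g * e" .
          then have "\<bar>blinfun_apply g (blinfun_apply T x) - blinfun_apply g (blinfun_apply T y)\<bar> \<le> e * norm g"
            by (simp add: blinfun.diff_right mult.commute)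
          moreover have "\<bar>blinfun_apply g (blinfun_apply T y) - \<xi> g\<bar> \<le> d"
            using y(1) by (simp add: C_def)
          ultimately show "\<bar>blinfun_apply g (blinfun_apply T x) - \<xi> g\<bar> \<le> e * norm g + d"
            by linarith
        qed
        then show ?thesis by blast
      qed
      then show "\<exists>y. \<forall>g. \<xi> g = blinfun_apply g y"
        using functional_in_range_if_approximable[of \<xi>] by metis
    qed
  qed
qed

end

end

text \<open>
  A gliding hump. Norming functionals \<open>g k\<close> of \<open>T (x k)\<close> are corrected by a weak* cluster point and
  then thinned out to \<open>h (\<kappa> 0), h (\<kappa> 1), \<dots>\<close>, which are almost biorthogonal to the \<open>T (x (\<kappa> j))\<close>.
  A weak cluster point \<open>y\<close> of the partial sums of \<open>\<Sum>\<^sub>j T (x (\<kappa> j))\<close> exists by weak compactness. Every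
  cluster point of the \<open>h (\<kappa> j)\<close> is bounded away from zero on all the remainders of \<open>y\<close>, although these
  remainders converge weakly to zero.
\<close>

lemma b_weakly_compact_disjoint_not_bounded_below:
  fixes T :: "'a::banach_lattice \<Rightarrow>\<^sub>L 'b::banach"
  assumes T: "b_weakly_compact T"
    and x: "disjoint_seq x" "range x \<subseteq> bidual_interval \<Phi>"
    and "0 < e" and below: "\<And>n. e \<le> norm (blinfun_apply T (x n))"
  shows False
proof -
  define t where "t n = blinfun_apply T (x n)" for n
  have summable_t: "summable (\<lambda>n. \<bar>blinfun_apply f (t n)\<bar>)" for f :: "'b \<Rightarrow>\<^sub>L real"
    using summable_disjoint[OF x, of "f o\<^sub>L T"] by (simp add: t_def)
  have t_null: "(\<lambda>n. blinfun_apply f (t n)) \<longlonglongrightarrow> 0" for f :: "'b \<Rightarrow>\<^sub>L real"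
    using summable_LIMSEQ_zero[OF summable_t[of f]] by (simp add: tendsto_rabs_zero_iff)
  have "\<exists>g :: 'b \<Rightarrow>\<^sub>L real. norm g \<le> 1 \<and> blinfun_apply g (t n) = norm (t n)" for n
    using exists_norming_functional[of "t n"] by metis
  then obtain g :: "nat \<Rightarrow> 'b \<Rightarrow>\<^sub>L real" where
    g: "\<And>n. norm (g n) \<le> 1" "\<And>n. blinfun_apply (g n) (t n) = norm (t n)" by metis
  obtain g0 :: "'b \<Rightarrow>\<^sub>L real" where g0: "norm g0 \<le> 1"
    "\<And>Z d N. finite Z \<Longrightarrow> 0 < d \<Longrightarrow> \<exists>k\<ge>N. \<forall>z\<in>Z. \<bar>blinfun_apply (g k) z - blinfun_apply g0 z\<bar> < d"
    using weak_star_cluster_point[of g 1, OF g(1)] by metis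
  \<comment> \<open>Zero is a weak* cluster point of the corrected functionals, so late ones can be
    chosen tiny on any finite set. The diagonal stays large because \<open>g0\<close> tends to zero
    along \<open>t\<close>.\<close>
  define h where "h k = g k - g0" for k
  have h_norm: "norm (h k) \<le> 2" for k
    using norm_triangle_ineq4[of "g k" g0] g(1)[of k] g0(1) by (simp add: h_def)
  have h_frequently: "\<exists>k\<ge>N. \<forall>z\<in>Z. \<bar>blinfun_apply (h k) z\<bar> < d" if "finite Z" "0 < d" for Z d N
    using g0(2)[OF that, of N] by (simp add: h_def blinfun.diff_left)
  \<comment> \<open>Earlier terms cost \<open>c\<close> and later ones at most \<open>2 * c\<close>,
    so \<open>e / 2 - 3 * c = e / 4\<close> of the diagonal term remains in
    \<open>hump\<close>.\<close>
  define c where "c = e / 12"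
  have c: "0 < c" using \<open>0 < e\<close> by (simp add: c_def)
  obtain N0 where N0: "\<And>n. N0 \<le> n \<Longrightarrow> \<bar>blinfun_apply g0 (t n)\<bar> < e / 2"
    using order_tendstoD(2)[OF tendsto_rabs_zero[OF t_null[of g0]], of "e / 2"] \<open>0 < e\<close>
    by (auto simp: eventually_sequentially)
  have h_diag: "e / 2 \<le> blinfun_apply (h n) (t n)" if "N0 \<le> n" for n
    using N0[OF that] below[of n] g(2)[of n] unfolding h_def blinfun.diff_left t_def by linarith

  \<comment> \<open>The new functional must be small on all old vectors, which the correction by
    \<open>g0\<close> permits, and the new vector small under all old functionals, which holds far
    out since \<open>t\<close> is weakly null.\<close>
  have "\<exists>\<kappa>. \<forall>j. N0 \<le> \<kappa> j \<and> (\<kappa> j < \<kappa> (Suc j)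
      \<and> (\<Sum>n\<le>\<kappa> j. \<bar>blinfun_apply (h (\<kappa> (Suc j))) (t n)\<bar>) \<le> c
      \<and> (\<forall>m\<le>\<kappa> j. \<bar>blinfun_apply (h m) (t (\<kappa> (Suc j)))\<bar> \<le> c * (1/2) ^ j))"
  proof (rule dependent_nat_choice)
    show "\<exists>k. N0 \<le> k" by blast
  next
    fix k j :: nat assume k: "N0 \<le> k"
    have "eventually (\<lambda>n. \<bar>blinfun_apply (h m) (t n)\<bar> < c * (1/2) ^ j) sequentially" for m
      using order_tendstoD(2)[OF tendsto_rabs_zero[OF t_null[of "h m"]]] c by simp
    then have "eventually (\<lambda>n. \<forall>m\<in>{..k}. \<bar>blinfun_apply (h m) (t n)\<bar> < c * (1/2) ^ j) sequentially"
      by (intro eventually_ball_finite) auto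
    then obtain N where N: "\<And>n m. N \<le> n \<Longrightarrow> m \<le> k \<Longrightarrow> \<bar>blinfun_apply (h m) (t n)\<bar> < c * (1/2) ^ j"
      by (auto simp: eventually_sequentially)
    obtain l where l: "max N (Suc k) \<le> l" "\<And>n. n \<le> k \<Longrightarrow> \<bar>blinfun_apply (h l) (t n)\<bar> < c / real (Suc k)"
      using h_frequently[of "t ` {..k}" "c / real (Suc k)" "max N (Suc k)"] c by auto
    have "(\<Sum>n\<le>k. \<bar>blinfun_apply (h l) (t n)\<bar>) \<le> (\<Sum>n\<le>k. c / real (Suc k))"
      using l(2) by (intro sum_mono less_imp_le) simp
    then have "(\<Sum>n\<le>k. \<bar>blinfun_apply (h l) (t n)\<bar>) \<le> c" by simp
    then show "\<exists>l. N0 \<le> l \<and> (k < l \<and> (\<Sum>n\<le>k. \<bar>blinfun_apply (h l) (t n)\<bar>) \<le> c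
        \<and> (\<forall>m\<le>k. \<bar>blinfun_apply (h m) (t l)\<bar> \<le> c * (1/2) ^ j))"
      using l(1) N[of l] k by (intro exI[of _ l]) (auto intro: less_imp_le)
  qed
  then obtain \<kappa> where \<kappa>: "\<And>j. N0 \<le> \<kappa> j" "\<And>j. \<kappa> j < \<kappa> (Suc j)"
    "\<And>j. (\<Sum>n\<le>\<kappa> j. \<bar>blinfun_apply (h (\<kappa> (Suc j))) (t n)\<bar>) \<le> c"
    "\<And>j m. m \<le> \<kappa> j \<Longrightarrow> \<bar>blinfun_apply (h m) (t (\<kappa> (Suc j)))\<bar> \<le> c * (1/2) ^ j"
    by blast
  have "strict_mono \<kappa>" using \<kappa>(2) by (rule strict_mono_Suc_iff[THEN iffD2, rule_format])
  have x\<kappa>: "disjoint_seq (\<lambda>j. x (\<kappa> j))" "range (\<lambda>j. x (\<kappa> j)) \<subseteq> bidual_interval \<Phi>"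
    using x strict_mono_eq[OF \<open>strict_mono \<kappa>\<close>] by (auto simp: disjoint_seq_def)
  define s where "s N = (\<Sum>j<N. t (\<kappa> j))" for N
  have apply_s: "blinfun_apply f (s N) = (\<Sum>j<N. blinfun_apply f (t (\<kappa> j)))" for f :: "'b \<Rightarrow>\<^sub>L real" and N
    by (simp add: s_def blinfun.sum_right)
  define A where "A = range (\<lambda>N. \<Sum>j<N. x (\<kappa> j))"
  have A: "A \<subseteq> bidual_interval \<Phi>"
    unfolding A_def using disjoint_sum_mem_bidual_interval[OF x\<kappa>] by blast
  moreover from A have "0 \<le> z" if "z \<in> A" for z
    using that by (auto simp: bidual_interval_def)
  ultimately have "b_order_bounded A"
    by (subst b_order_bounded_nonneg_iff) auto
  then have "relatively_weakly_compact (blinfun_apply T ` A)"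
    using T by (simp add: b_weakly_compact_def)
  moreover have "s N \<in> blinfun_apply T ` A" for N
    unfolding A_def s_def t_def blinfun.sum_right[symmetric] by blast
  ultimately obtain y where
    y: "\<And>(f :: 'b \<Rightarrow>\<^sub>L real) L. (\<lambda>N. blinfun_apply f (s N)) \<longlonglongrightarrow> L \<Longrightarrow> blinfun_apply f y = L"
    by (rule weak_cluster_point[of "blinfun_apply T ` A" s]) blast
  \<comment> \<open>Each functional is summable along the disjoint sequence, so the cluster point is
    the weak limit of all partial sums.\<close>
  have s_lim: "(\<lambda>N. blinfun_apply f (s N)) \<longlonglongrightarrow> blinfun_apply f y" for f :: "'b \<Rightarrow>\<^sub>L real"
  proof -
    have "summable (\<lambda>j. \<bar>blinfun_apply (f o\<^sub>L T) (x (\<kappa> j))\<bar>)"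
      using x\<kappa> by (rule summable_disjoint)
    then have "summable (\<lambda>j. \<bar>blinfun_apply f (t (\<kappa> j))\<bar>)"
      by (simp add: t_def)
    then have "summable (\<lambda>j. blinfun_apply f (t (\<kappa> j)))"
      by (rule summable_rabs_cancel)
    then have lim: "(\<lambda>N. blinfun_apply f (s N)) \<longlonglongrightarrow> (\<Sum>j. blinfun_apply f (t (\<kappa> j)))"
      unfolding apply_s by (rule summable_LIMSEQ)
    with y[OF lim] show ?thesis by (simp only:)
  qed

  have hump: "e / 4 \<le> blinfun_apply (h (\<kappa> j)) (y - s i)" if "i \<le> j" for i j
  proof -
    define a where "a l = blinfun_apply (h (\<kappa> j)) (t (\<kappa> l))" for l
    have before: "(\<Sum>l<j. \<bar>a l\<bar>) \<le> c"
    proof (cases j)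
      case (Suc j')
      have "(\<Sum>l<j. \<bar>a l\<bar>) = (\<Sum>n\<in>\<kappa> ` {..<j}. \<bar>blinfun_apply (h (\<kappa> j)) (t n)\<bar>)"
        unfolding a_def
        using strict_mono_imp_inj_on[OF \<open>strict_mono \<kappa>\<close>] by (subst sum.reindex) (auto intro: inj_on_subset)
      also have "\<dots> \<le> (\<Sum>n\<le>\<kappa> j'. \<bar>blinfun_apply (h (\<kappa> j)) (t n)\<bar>)"
        using strict_mono_less_eq[OF \<open>strict_mono \<kappa>\<close>] by (intro sum_mono2) (auto simp: Suc)
      also have "\<dots> \<le> c"
        using \<kappa>(3)[of j'] by (simp add: Suc)
      finally show ?thesis .
    qed (use c in simp)
    have after: "(\<Sum>l=Suc j..<N. \<bar>a l\<bar>) \<le> c * 2" for N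
    proof (cases N)
      case (Suc N')
      have "(\<Sum>l=Suc j..<N. \<bar>a l\<bar>) = (\<Sum>l=j..<N'. \<bar>a (Suc l)\<bar>)"
        unfolding Suc by (rule sum.shift_bounds_Suc_ivl)
      also have "\<dots> \<le> (\<Sum>l=j..<N'. c * (1/2) ^ l)"
        using strict_mono_less_eq[OF \<open>strict_mono \<kappa>\<close>] unfolding a_def by (intro sum_mono \<kappa>(4)) auto
      also have "\<dots> \<le> c * 2"
        unfolding sum_distrib_left[symmetric] using c by (intro mult_left_mono sum_half_powers_le) auto
      finally show ?thesis .
    qed (use c in simp)
    have "e / 4 \<le> blinfun_apply (h (\<kappa> j)) (s N - s i)" if "j < N" for N
    proof -
      have "blinfun_apply (h (\<kappa> j)) (s N - s i) = (\<Sum>l=i..<N. a l)"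
        using \<open>i \<le> j\<close> \<open>j < N\<close> unfolding blinfun.diff_right apply_s a_def lessThan_atLeast0
        by (intro sum_diff_nat_ivl) auto
      also have "\<dots> = (\<Sum>l=i..<j. a l) + (\<Sum>l=j..<N. a l)"
        using \<open>i \<le> j\<close> \<open>j < N\<close> by (simp add: sum.atLeastLessThan_concat)
      also have "(\<Sum>l=j..<N. a l) = a j + (\<Sum>l=Suc j..<N. a l)"
        using \<open>j < N\<close> by (rule sum.atLeast_Suc_lessThan)
      finally have "blinfun_apply (h (\<kappa> j)) (s N - s i)
          = (\<Sum>l=i..<j. a l) + (a j + (\<Sum>l=Suc j..<N. a l))" .
      moreover have "(\<Sum>l=i..<j. a l) \<ge> - c"
      proof -
        have "\<bar>\<Sum>l=i..<j. a l\<bar> \<le> (\<Sum>l=i..<j. \<bar>a l\<bar>)" by (rule sum_abs)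
        also have "\<dots> \<le> (\<Sum>l<j. \<bar>a l\<bar>)" by (intro sum_mono2) auto
        finally show ?thesis using before by linarith
      qed
      moreover have "(\<Sum>l=Suc j..<N. a l) \<ge> - (c * 2)"
        using sum_abs[of a "{Suc j..<N}"] after[of N] by linarith
      moreover have "e / 2 \<le> a j"
        unfolding a_def by (rule h_diag) (rule \<kappa>(1))
      ultimately show ?thesis
        unfolding c_def by linarith
    qed
    then have "eventually (\<lambda>N. e / 4 \<le> blinfun_apply (h (\<kappa> j)) (s N - s i)) sequentially"
      by (rule eventually_mono[OF eventually_gt_at_top[of j]])
    moreover have "(\<lambda>N. blinfun_apply (h (\<kappa> j)) (s N - s i)) \<longlonglongrightarrow> blinfun_apply (h (\<kappa> j)) (y - s i)"
      unfolding blinfun.diff_right by (intro tendsto_diff s_lim tendsto_const)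
    ultimately show ?thesis
      by (intro tendsto_lowerbound[of "\<lambda>N. blinfun_apply (h (\<kappa> j)) (s N - s i)" _ sequentially]) auto
  qed

  obtain h0 :: "'b \<Rightarrow>\<^sub>L real" where h0:
    "\<And>Z d N. finite Z \<Longrightarrow> 0 < d \<Longrightarrow> \<exists>j\<ge>N. \<forall>z\<in>Z. \<bar>blinfun_apply (h (\<kappa> j)) z - blinfun_apply h0 z\<bar> < d"
    using weak_star_cluster_point[of "\<lambda>j. h (\<kappa> j)" 2, OF h_norm] by metis
  \<comment> \<open>Passing to the cluster point \<open>h0\<close> costs less than
    \<open>e / 8\<close> of the \<open>e / 4\<close> in \<open>hump\<close>; one \<open>h0\<close>
    serves all remainders, since arbitrarily late \<open>j\<close> are available for each
    \<open>i\<close>.\<close>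
  have "e / 8 \<le> blinfun_apply h0 y - blinfun_apply h0 (s i)" for i
  proof -
    obtain j where "i \<le> j" "\<bar>blinfun_apply (h (\<kappa> j)) (y - s i) - blinfun_apply h0 (y - s i)\<bar> < e / 8"
      using h0[of "{y - s i}" "e / 8" i] \<open>0 < e\<close> by auto
    with hump[of i j] show ?thesis
      unfolding blinfun.diff_right by linarith
  qed
  moreover have "(\<lambda>i. blinfun_apply h0 y - blinfun_apply h0 (s i)) \<longlonglongrightarrow> blinfun_apply h0 y - blinfun_apply h0 y"
    by (intro tendsto_diff s_lim tendsto_const)
  ultimately have "e / 8 \<le> blinfun_apply h0 y - blinfun_apply h0 y"
    by (intro tendsto_lowerbound) auto
  with \<open>0 < e\<close> show False by simp
qed

lemma b_weakly_compact_disjoint_tendsto_zero: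
  fixes T :: "'a::banach_lattice \<Rightarrow>\<^sub>L 'b::banach"
  assumes "b_weakly_compact T" "disjoint_seq x" "range x \<subseteq> bidual_interval \<Phi>"
  shows "(\<lambda>n. norm (blinfun_apply T (x n))) \<longlonglongrightarrow> 0"
proof (rule ccontr)
  assume "\<not> ?thesis"
  then obtain e where e: "0 < e" "\<And>N. \<exists>n\<ge>N. e \<le> norm (blinfun_apply T (x n))"
    unfolding lim_sequentially by (auto simp: not_less)
  then have "infinite {n. e \<le> norm (blinfun_apply T (x n))}"
    unfolding infinite_nat_iff_unbounded_le by blast
  from infinite_enumerate[OF this]
  obtain r :: "nat \<Rightarrow> nat" where r: "strict_mono r" "\<And>n. e \<le> norm (blinfun_apply T (x (r n)))"
    by auto
  show False
  proof (rule b_weakly_compact_disjoint_not_bounded_below[OF assms(1)])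
    show "disjoint_seq (\<lambda>n. x (r n))"
      using assms(2) strict_mono_eq[OF r(1)] by (simp add: disjoint_seq_def)
    show "range (\<lambda>n. x (r n)) \<subseteq> bidual_interval \<Phi>"
      using assms(3) by blast
  qed (use e(1) r(2) in auto)
qed

theorem theorem2p22:
  fixes T :: "'a::banach_lattice \<Rightarrow>\<^sub>L 'b::banach"
  shows
    "(b_weakly_compact T \<longleftrightarrow>
        (\<forall>x::nat \<Rightarrow> 'a. (\<forall>n. 0 \<le> x n) \<and> b_order_bounded (range x) \<and> uaw_null x
          \<longrightarrow> (\<lambda>n. q_seminorm T (x n)) \<longlonglongrightarrow> 0)) \<and>
     (b_weakly_compact T \<longleftrightarrow>
        (\<forall>x::nat \<Rightarrow> 'a. (\<forall>n. 0 \<le> x n) \<and> b_order_bounded (range x) \<and> uaw_null x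
          \<longrightarrow> (\<lambda>n. norm (blinfun_apply T (x n))) \<longlonglongrightarrow> 0)) \<and>
     (b_weakly_compact T \<longleftrightarrow>
        (\<forall>x::nat \<Rightarrow> 'a. (\<forall>n. 0 \<le> x n) \<and> b_order_bounded (range x) \<and> disjoint_seq x
          \<longrightarrow> (\<lambda>n. norm (blinfun_apply T (x n))) \<longlonglongrightarrow> 0))"
    (is "(?bwc \<longleftrightarrow> ?uaw_q) \<and> (?bwc \<longleftrightarrow> ?uaw_T) \<and> (?bwc \<longleftrightarrow> ?disj)")
proof -
  have interval: "\<exists>\<Phi>. range x \<subseteq> bidual_interval \<Phi>"
    if "\<forall>n. 0 \<le> x n" "b_order_bounded (range x)" for x :: "nat \<Rightarrow> 'a"
    using that(2) by (rule b_order_bounded_nonneg_iff[THEN iffD1, rotated]) (use that(1) in auto)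
  have nonneg: "(\<forall>n. 0 \<le> x n) \<and> b_order_bounded (range x)" if "range x \<subseteq> bidual_interval \<Phi>"
    for x :: "nat \<Rightarrow> 'a" and \<Phi>
  proof -
    have "\<forall>n. 0 \<le> x n" using that by (auto simp: bidual_interval_def)
    moreover from this have "b_order_bounded (range x)"
      using that by (subst b_order_bounded_nonneg_iff) auto
    ultimately show ?thesis ..
  qed
  have bwc_disj: ?disj if ?bwc
    using b_weakly_compact_disjoint_tendsto_zero[OF that] interval by blast
  have null: "lattice_seminorm.disjoint_null (q_seminorm T) (bidual_interval \<Phi>)" if ?disj for \<Phi>
    using that nonneg by (intro disjoint_null_bidual_interval) blast
  have disj_bwc: ?bwc if ?disj
    using null[OF that] by (rule b_weakly_compact_if_disjoint_null)
  have disj_uaw_q: ?uaw_q if ?disj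
    using uaw_null_imp_q_seminorm_tendsto_zero[OF null[OF that]] interval by blast
  have uaw_q_T: ?uaw_T if ?uaw_q
  proof (intro allI impI)
    fix x :: "nat \<Rightarrow> 'a"
    assume "(\<forall>n. 0 \<le> x n) \<and> b_order_bounded (range x) \<and> uaw_null x"
    with that have "(\<lambda>n. q_seminorm T (x n)) \<longlonglongrightarrow> 0" by blast
    then show "(\<lambda>n. norm (blinfun_apply T (x n))) \<longlonglongrightarrow> 0"
      by (rule tendsto_sandwich[OF _ _ tendsto_const, rotated 2]) (simp_all add: q_seminorm_upper)
  qed
  have uaw_T_disj: ?disj if ?uaw_T
    using that disjoint_imp_uaw_null by blast
  show ?thesis
    using bwc_disj disj_bwc disj_uaw_q uaw_q_T uaw_T_disj by blast
qed

end
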